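(* Let $n\ge 2$ be an integer. The poset $\mathrm{Poset}(\mathrm{PF}_{n,n})$ is irreducible as a direct product of posets: it is not isomorphic to a direct product $P\times Q$ of two posets $P$ and $Q$ each having more than one element.
   Context: Write $[n]=\{1,\dots,n\}$. A parking function of length $n$ is an $n$-tuple $(a_1,\dots,a_n)$ of positive integers whose weakly increasing rearrangement $b_1\le\dots\le b_n$ satisfies $b_i\le i$ for all $i$; $\mathrm{PF}_n$ is the set of these. For $n\ge 2$, $\mathrm{PF}_{n,n}$ is the set of $a\in\mathrm{PF}_n$ such that $n$ is not an entry of $a$. $\mathrm{NC}_m$ is the lattice of noncrossing partitions of $[m]$ (partitions for which, placing $1,\dots,m$ in clockwise order on a circle, the convex hulls of the blocks are pairwise disjoint), ordered by refinement, with the finer partition being smaller. Each covering relation $\sigma<\tau$ in $\mathrm{NC}_{n+1}$ merges two blocks $B_1,B_2$ of $\sigma$ into one block $B=B_1\cup B_2$ of $\tau$; name them so that $\min B\in B_1$, and label the covering relation by the largest element of $B_1$ that is less than every element of $B_2$. Reading the labels of a maximal chain of $\mathrm{NC}_{n+1}$ from bottom to top gives a parking function of length $n$, and this is a (known) bijection from maximal chains of $\mathrm{NC}_{n+1}$ to $\mathrm{PF}_n$. $\mathrm{Poset}(\mathrm{PF}_{n,n})$ is the poset whose Hasse diagram is the union of the maximal chains of $\mathrm{NC}_{n+1}$ corresponding to elements of $\mathrm{PF}_{n,n}$: its elements are the noncrossing partitions lying on at least one of these chains, and its order is the reflexive-transitive closure of the covering relations occurring in these chains (it need not be an induced subposet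 of $\mathrm{NC}_{n+1}$). *)

theory Defs
  imports "HOL-Analysis.Analysis"
begin

section \<open>Parking functions\<close>

definition parking_functions :: "nat \<Rightarrow> nat list set" where
  "parking_functions n =
     {a. length a = n \<and> (\<forall>x\<in>set a. 1 \<le> x) \<and> (\<forall>i<n. sort a ! i \<le> i + 1)}"

text \<open>The set written $\mathrm{PF}_{n,n}$: the second index is the forbidden entry.\<close>

definition parking_functions_without_max :: "nat \<Rightarrow> nat list set" where
  "parking_functions_without_max n = {a \<in> parking_functions n. n \<notin> set a}"


section \<open>Noncrossing partitions\<close>

text \<open>The points $1,\dots,m$ are placed as the vertices of a regular polygon,
  in clockwise order (hence the minus sign).\<close>

definition circle_point :: "nat \<Rightarrow> nat \<Rightarrow> complex" where
  "circle_point m k = cis (- (2 * pi * real k / real m))"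

definition noncrossing_partitions :: "nat \<Rightarrow> nat set set set" where
  "noncrossing_partitions m =
     {\<sigma>. partition_on {1..m} \<sigma> \<and>
         pairwise (\<lambda>B C. disjnt (convex hull (circle_point m ` B)) (convex hull (circle_point m ` C))) \<sigma>}"

definition strictly_refines :: "nat \<Rightarrow> nat set set \<Rightarrow> nat set set \<Rightarrow> bool" where
  "strictly_refines m \<sigma> \<tau> \<longleftrightarrow> refines {1..m} \<sigma> \<tau> \<and> \<sigma> \<noteq> \<tau>"

text \<open>A maximal chain is represented by the list of its elements from bottom to top.\<close>

definition maximal_chains :: "nat \<Rightarrow> nat set set list set" where
  "maximal_chains m =
     {c. sorted_wrt (strictly_refines m) c \<and>
         pred_on.maxchain (noncrossing_partitions m) (strictly_refines m) (set c)}"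

text \<open>The value is meaningful only if \<open>\<tau>\<close> arises from \<open>\<sigma>\<close> by merging two blocks, as is the case
  for covering relations; see \<open>cover_label_eq\<close> below.\<close>

definition cover_label :: "nat set set \<Rightarrow> nat set set \<Rightarrow> nat" where
  "cover_label \<sigma> \<tau> = (THE k. \<exists>B\<^sub>1\<in>\<sigma>. \<exists>B\<^sub>2\<in>\<sigma>.
      B\<^sub>1 \<noteq> B\<^sub>2 \<and> \<tau> = insert (B\<^sub>1 \<union> B\<^sub>2) (\<sigma> - {B\<^sub>1, B\<^sub>2}) \<and> Min (B\<^sub>1 \<union> B\<^sub>2) \<in> B\<^sub>1 \<and>
      k = Max {x \<in> B\<^sub>1. \<forall>y\<in>B\<^sub>2. x < y})"

definition chain_labels :: "nat set set list \<Rightarrow> nat list" where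
  "chain_labels c = map (\<lambda>i. cover_label (c ! i) (c ! Suc i)) [0..<length c - 1]"


section \<open>The poset of a set of parking functions\<close>

text \<open>Here \<open>X\<close> is a set of parking functions of length \<open>n\<close>.\<close>

definition pf_chains :: "nat \<Rightarrow> nat list set \<Rightarrow> nat set set list set" where
  "pf_chains n X = {c \<in> maximal_chains (n + 1). chain_labels c \<in> X}"

definition pf_poset :: "nat \<Rightarrow> nat list set \<Rightarrow> nat set set set" where
  "pf_poset n X = (\<Union>c\<in>pf_chains n X. set c)"

definition pf_covers :: "nat \<Rightarrow> nat list set \<Rightarrow> nat set set rel" where
  "pf_covers n X = {(c ! i, c ! Suc i) |c i. c \<in> pf_chains n X \<and> Suc i < length c}"

text \<open>The restriction to the carrier only removes the reflexive pairs outside it.\<close>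

definition pf_order :: "nat \<Rightarrow> nat list set \<Rightarrow> nat set set rel" where
  "pf_order n X = (pf_covers n X)\<^sup>* \<inter> (pf_poset n X \<times> pf_poset n X)"


section \<open>Products and isomorphisms of posets\<close>

definition prod_order :: "'a rel \<Rightarrow> 'b rel \<Rightarrow> ('a \<times> 'b) rel" where
  "prod_order R S = {((p, q), (p', q')). (p, p') \<in> R \<and> (q, q') \<in> S}"

definition poset_isomorphic :: "'a set \<Rightarrow> 'a rel \<Rightarrow> 'b set \<Rightarrow> 'b rel \<Rightarrow> bool" where
  "poset_isomorphic A R B S \<longleftrightarrow>
     (\<exists>f. bij_betw f A B \<and> (\<forall>x\<in>A. \<forall>y\<in>A. (x, y) \<in> R \<longleftrightarrow> (f x, f y) \<in> S))"


section \<open>Well-definedness\<close>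

lemma cover_label_eq:
  assumes "partition_on A \<sigma>" "B\<^sub>1 \<in> \<sigma>" "B\<^sub>2 \<in> \<sigma>" "B\<^sub>1 \<noteq> B\<^sub>2"
    and "\<tau> = insert (B\<^sub>1 \<union> B\<^sub>2) (\<sigma> - {B\<^sub>1, B\<^sub>2})" "Min (B\<^sub>1 \<union> B\<^sub>2) \<in> B\<^sub>1"
  shows "cover_label \<sigma> \<tau> = Max {x \<in> B\<^sub>1. \<forall>y\<in>B\<^sub>2. x < y}"
proof -
  have diff: "\<sigma> - insert (B \<union> C) (\<sigma> - {B, C}) = {B, C}" if "B \<in> \<sigma>" "C \<in> \<sigma>" "B \<noteq> C" for B C
  proof -
    have "B \<inter> C = {}" "B \<noteq> {}" "C \<noteq> {}"
      using that assms(1) by (auto simp: partition_on_def disjoint_def)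
    then have "B \<union> C \<noteq> B" "B \<union> C \<noteq> C" by blast+
    then show ?thesis using that by auto
  qed
  have uniq: "C\<^sub>1 = B\<^sub>1 \<and> C\<^sub>2 = B\<^sub>2"
    if "C\<^sub>1 \<in> \<sigma>" "C\<^sub>2 \<in> \<sigma>" "C\<^sub>1 \<noteq> C\<^sub>2" "\<tau> = insert (C\<^sub>1 \<union> C\<^sub>2) (\<sigma> - {C\<^sub>1, C\<^sub>2})"
      "Min (C\<^sub>1 \<union> C\<^sub>2) \<in> C\<^sub>1" for C\<^sub>1 C\<^sub>2
  proof -
    have eq: "{C\<^sub>1, C\<^sub>2} = {B\<^sub>1, B\<^sub>2}"
      using diff[of C\<^sub>1 C\<^sub>2] diff[of B\<^sub>1 B\<^sub>2] that assms by metis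
    have "B\<^sub>1 \<inter> B\<^sub>2 = {}"
      using assms(1-4) by (auto simp: partition_on_def disjoint_def)
    with eq that(5) assms(6) show ?thesis
      by (auto simp: doubleton_eq_iff Un_commute)
  qed
  show ?thesis
    unfolding cover_label_def
  proof (rule the_equality)
    show "\<exists>C\<^sub>1\<in>\<sigma>. \<exists>C\<^sub>2\<in>\<sigma>. C\<^sub>1 \<noteq> C\<^sub>2 \<and> \<tau> = insert (C\<^sub>1 \<union> C\<^sub>2) (\<sigma> - {C\<^sub>1, C\<^sub>2}) \<and>
        Min (C\<^sub>1 \<union> C\<^sub>2) \<in> C\<^sub>1 \<and> Max {x \<in> B\<^sub>1. \<forall>y\<in>B\<^sub>2. x < y} = Max {x \<in> C\<^sub>1. \<forall>y\<in>C\<^sub>2. x < y}"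
      using assms(2-6) by (intro bexI[of _ B\<^sub>1] bexI[of _ B\<^sub>2] conjI refl)
  next
    fix k
    assume "\<exists>C\<^sub>1\<in>\<sigma>. \<exists>C\<^sub>2\<in>\<sigma>. C\<^sub>1 \<noteq> C\<^sub>2 \<and> \<tau> = insert (C\<^sub>1 \<union> C\<^sub>2) (\<sigma> - {C\<^sub>1, C\<^sub>2}) \<and>
        Min (C\<^sub>1 \<union> C\<^sub>2) \<in> C\<^sub>1 \<and> k = Max {x \<in> C\<^sub>1. \<forall>y\<in>C\<^sub>2. x < y}"
    then obtain C\<^sub>1 C\<^sub>2 where C: "C\<^sub>1 \<in> \<sigma>" "C\<^sub>2 \<in> \<sigma>" "C\<^sub>1 \<noteq> C\<^sub>2"
        "\<tau> = insert (C\<^sub>1 \<union> C\<^sub>2) (\<sigma> - {C\<^sub>1, C\<^sub>2})" "Min (C\<^sub>1 \<union> C\<^sub>2) \<in> C\<^sub>1"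
        "k = Max {x \<in> C\<^sub>1. \<forall>y\<in>C\<^sub>2. x < y}"
      by (elim bexE conjE)
    from uniq[OF C(1-5)] C(6) show "k = Max {x \<in> B\<^sub>1. \<forall>y\<in>B\<^sub>2. x < y}"
      by simp
  qed
qed

lemma partial_order_on_pf_order: "partial_order_on (pf_poset n X) (pf_order n X)"
proof -
  let ?r = "{(\<sigma>, \<tau>). \<sigma> = \<tau> \<or> refines {1..n + 1} \<sigma> \<tau>}"
  have "pf_covers n X \<subseteq> ?r"
    by (auto simp: pf_covers_def pf_chains_def maximal_chains_def strictly_refines_def
        sorted_wrt_iff_nth_less)
  moreover have "trans ?r"
    by (intro transI) (auto intro: refines_trans)
  ultimately have sub: "pf_covers n X \<subseteq> ?r" and tr: "trans ?r"
    by blast+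
  have "(\<sigma>, \<tau>) \<in> ?r" if "(\<sigma>, \<tau>) \<in> (pf_covers n X)\<^sup>*" for \<sigma> \<tau>
    using that
  proof (induction rule: rtrancl_induct)
    case base
    then show ?case by simp
  next
    case (step \<rho> \<tau>)
    then have "(\<rho>, \<tau>) \<in> ?r" using sub by (meson subsetD)
    with tr step.IH show ?case by (rule transD)
  qed
  then have "(pf_covers n X)\<^sup>* \<subseteq> ?r"
    by (rule subrelI)
  moreover have "antisym ?r"
    by (intro antisymI) (auto dest: refines_asym)
  ultimately have "antisym ((pf_covers n X)\<^sup>*)"
    by (meson antisym_subset)
  then show ?thesis
    by (auto simp: pf_order_def partial_order_on_def preorder_on_def refl_on_def antisym_def
        intro!: transI)
qed

lemma partial_order_on_prod_order:
  assumes "partial_order_on P R" "partial_order_on Q S"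
  shows "partial_order_on (P \<times> Q) (prod_order R S)"
  using assms unfolding partial_order_on_def preorder_on_def prod_order_def
  by (intro conjI transI antisymI) (auto simp: refl_on_def elim: transE dest: antisymD)

end

theory Submission
  imports Defs
begin

text \<open>In a product of two posets with a least element, every atom belongs to one of the two factors,
  and two atoms of different factors have a common cover that lies above exactly four elements.
  Here the atoms are given by pairs \<open>{i, j}\<close>. For \<open>i < j < n\<close> the partition with the single
  nontrivial block \<open>{i, j, n + 1}\<close> lies above three atoms, so these belong to the same factor;
  this puts all atoms \<open>{i, j}\<close> avoiding \<open>n\<close> into one factor. Once \<open>1\<close> and \<open>n\<close> share a block and
  \<open>n + 1\<close> is a singleton, absorbing \<open>n + 1\<close> has label \<open>n\<close>, so such partitions are not in the poset.
  Hence \<open>{i, n}\<close> and \<open>{1, i}\<close> have no common cover of rank two and belong to the same factor as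
  well, while \<open>{1, n}\<close> and \<open>{n, n + 1}\<close> are not atoms. So all atoms lie in one factor, and the
  other factor is trivial.\<close>

section \<open>Crossing blocks\<close>

text \<open>The forbidden label pins down one kind of merge. A cover has label \<open>n\<close>
  exactly when \<open>{n + 1}\<close> is merged with a block containing \<open>n\<close>, because
  the block without the minimum must lie above \<open>n\<close>. Hence a chain is safe once
  \<open>n + 1\<close> has joined a block that avoids \<open>n\<close>, and any continuation is
  allowed; this is why the triangles contain \<open>n + 1\<close> and not \<open>n\<close>.
  Conversely, while \<open>1\<close> and \<open>n\<close> share a block and \<open>n + 1\<close> is
  alone, any other partner of \<open>n + 1\<close> would produce a crossing, and yet
  \<open>n + 1\<close> has to be absorbed before the top. The order is not inherited from the
  noncrossing lattice, so comparability there proves nothing here. Relations are obtained from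
  explicit maximal chains, and excluded because no noncrossing partition lies strictly between two
  consecutive members of a maximal chain. As noncrossing is defined by convex hulls, a translation
  into a pattern of four points has to come before all this.\<close>

definition crossing :: "nat set \<Rightarrow> nat set \<Rightarrow> bool" where
  "crossing B C \<longleftrightarrow> (\<exists>a b c d. a < b \<and> b < c \<and> c < d \<and>
     (a \<in> B \<and> b \<in> C \<and> c \<in> B \<and> d \<in> C \<or> a \<in> C \<and> b \<in> B \<and> c \<in> C \<and> d \<in> B))"

lemma crossing_commute: "crossing B C \<longleftrightarrow> crossing C B"
  unfolding crossing_def by blast

text \<open>Twice the signed area of the triangle \<open>x\<close>, \<open>y\<close>,
  \<open>z\<close>; negative for clockwise order.\<close>

definition orientation :: "complex \<Rightarrow> complex \<Rightarrow> complex \<Rightarrow> real" where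
  "orientation x y z = (Re y - Re x) * (Im z - Im x) - (Im y - Im x) * (Re z - Re x)"

text \<open>For a triangle inscribed in the unit circle the signed area is a product of sines of
  half arcs, so its sign is known once every half arc lies between \<open>0\<close> and
  \<open>pi\<close>.\<close>

lemma orientation_cis:
  "orientation (cis (- x)) (cis (- y)) (cis (- z))
     = - (4 * sin ((y - x) / 2) * sin ((z - y) / 2) * sin ((z - x) / 2))"
proof -
  define u v where "u = (y - x) / 2" and "v = (z - y) / 2"
  have halves: "(y - x) / 2 = u" "(z - y) / 2 = v" "(z - x) / 2 = u + v"
    by (auto simp: u_def v_def field_simps)
  have d: "y - x = 2 * u" "z - y = 2 * v" "z - x = 2 * (u + v)"
    by (auto simp: u_def v_def field_simps)
  have "orientation (cis (- x)) (cis (- y)) (cis (- z))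
      = - (sin (y - x) + sin (z - y) - sin (z - x))"
    by (simp add: orientation_def sin_diff algebra_simps)
  also have "sin (y - x) + sin (z - y) = 2 * sin (u + v) * cos (u - v)"
    using sin_plus_sin[of "2 * u" "2 * v"] unfolding d by (simp add: add_divide_distrib diff_divide_distrib)
  also have "sin (z - x) = 2 * sin (u + v) * cos (u + v)"
    unfolding d by (rule sin_double)
  finally show ?thesis
    unfolding halves by (simp add: cos_add cos_diff algebra_simps)
qed

lemma orientation_circle_point_neg:
  assumes "1 \<le> a" "a < b" "b < c" "c \<le> m"
  shows "orientation (circle_point m a) (circle_point m b) (circle_point m c) < 0"
proof -
  have pos: "0 < sin ((2 * pi * real k / real m - 2 * pi * real j / real m) / 2)"
    if "1 \<le> j" "j < k" "k \<le> m" for j k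
  proof -
    have "(2 * pi * real k / real m - 2 * pi * real j / real m) / 2 = pi * ((real k - real j) / real m)"
      using that by (simp add: field_simps)
    moreover have "0 < (real k - real j) / real m" "(real k - real j) / real m < 1"
      using that by (auto simp: field_simps)
    then have "0 < pi * ((real k - real j) / real m)" "pi * ((real k - real j) / real m) < pi"
      using pi_gt_zero by (metis mult_pos_pos, metis mult.right_neutral mult_less_cancel_left_pos)
    ultimately show ?thesis
      by (metis sin_gt_zero)
  qed
  show ?thesis
    unfolding circle_point_def orientation_cis using pos assms by (simp add: zero_less_mult_iff)
qed

text \<open>With the signed areas of the four triangles as weights, the two chords get a common point.\<close>

lemma crossing_chords_meet:
  assumes "1 \<le> a" "a < b" "b < c" "c < d" "d \<le> m"
  shows "\<not> disjnt (convex hull {circle_point m a, circle_point m c})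
                    (convex hull {circle_point m b, circle_point m d})"
proof -
  define A B C D where "A = circle_point m a" and "B = circle_point m b"
    and "C = circle_point m c" and "D = circle_point m d"
  define p q r s where "p = - orientation B C D" and "q = - orientation A B D"
    and "r = - orientation A C D" and "s = - orientation A B C"
  have pos: "0 < p" "0 < q" "0 < r" "0 < s"
    using assms by (auto simp: p_def q_def r_def s_def A_def B_def C_def D_def
        intro!: orientation_circle_point_neg)
  \<comment> \<open>Both sums are twice the area of the quadrilateral, cut along one diagonal or the
    other.\<close>
  have eq: "p + q = r + s"
    by (simp add: p_def q_def r_def s_def orientation_def algebra_simps)
  have "p *\<^sub>R A + q *\<^sub>R C = r *\<^sub>R B + s *\<^sub>R D"
    by (simp add: complex_eq_iff p_def q_def r_def s_def orientation_def algebra_simps)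
  then have *: "(1 / (p + q)) *\<^sub>R (p *\<^sub>R A + q *\<^sub>R C) = (1 / (r + s)) *\<^sub>R (r *\<^sub>R B + s *\<^sub>R D)"
    by (simp add: eq)
  have "(p / (p + q)) *\<^sub>R A + (q / (p + q)) *\<^sub>R C \<in> convex hull {A, C}"
    using pos unfolding convex_hull_2
    by (intro CollectI exI[of _ "p / (p + q)"] exI[of _ "q / (p + q)"]) (simp flip: add_divide_distrib)
  moreover have "(r / (r + s)) *\<^sub>R B + (s / (r + s)) *\<^sub>R D \<in> convex hull {B, D}"
    using pos unfolding convex_hull_2
    by (intro CollectI exI[of _ "r / (r + s)"] exI[of _ "s / (r + s)"]) (simp flip: add_divide_distrib)
  moreover have "(p / (p + q)) *\<^sub>R A + (q / (p + q)) *\<^sub>R C = (r / (r + s)) *\<^sub>R B + (s / (r + s)) *\<^sub>R D"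
    using * by (simp add: scaleR_add_right)
  ultimately show ?thesis
    unfolding disjnt_iff A_def B_def C_def D_def by metis
qed

lemma crossing_imp_hulls_meet:
  assumes "crossing B C" "B \<subseteq> {1..m}" "C \<subseteq> {1..m}"
  shows "\<not> disjnt (convex hull (circle_point m ` B)) (convex hull (circle_point m ` C))"
proof -
  have *: "\<not> disjnt (convex hull (circle_point m ` X)) (convex hull (circle_point m ` Y))"
    if "a < b" "b < c" "c < d" "a \<in> X" "b \<in> Y" "c \<in> X" "d \<in> Y"
      "X \<subseteq> {1..m}" "Y \<subseteq> {1..m}" for a b c d X Y
  proof -
    have "1 \<le> a" "d \<le> m" using that by auto
    from crossing_chords_meet[OF this(1) that(1-3) this(2)] show ?thesis
      using that hull_mono[of "{circle_point m a, circle_point m c}" "circle_point m ` X" convex]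
        hull_mono[of "{circle_point m b, circle_point m d}" "circle_point m ` Y" convex]
      by (auto simp: disjnt_iff)
  qed
  from assms(1) obtain a b c d where abcd: "a < b" "b < c" "c < d"
    "a \<in> B \<and> b \<in> C \<and> c \<in> B \<and> d \<in> C \<or> a \<in> C \<and> b \<in> B \<and> c \<in> C \<and> d \<in> B"
    unfolding crossing_def by blast
  then show ?thesis
    using *[OF abcd(1-3), of B C] *[OF abcd(1-3), of C B] assms(2,3) disjnt_sym by blast
qed

text \<open>The linear functional is the height above the chord from \<open>p\<close> to \<open>q\<close>; the value \<open>q = m + 1\<close>
  stands for the point \<open>1\<close>.\<close>

lemma disjnt_hulls_of_gap:
  fixes p q m :: nat
  assumes "1 \<le> p" "p < q" "q \<le> m + 1"
    and C: "C \<subseteq> {p<..<q}" and B: "B \<subseteq> {1..p} \<union> {q..m}"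
  shows "disjnt (convex hull (circle_point m ` B)) (convex hull (circle_point m ` C))"
proof -
  \<comment> \<open>\<open>\<mu>\<close> is the clockwise angle of the midpoint of the arc from
    \<open>p\<close> to \<open>q\<close> and \<open>h\<close> is half the length of this arc, so
    \<open>cos h\<close> is the height of the chord in the direction \<open>w\<close>.\<close>
  define \<mu> h where "\<mu> = pi * (real p + real q) / real m" and "h = pi * (real q - real p) / real m"
  define w where "w = cis (- \<mu>)"
  have m: "0 < real m" using assms by auto
  have inner: "w \<bullet> circle_point m k = cos (2 * pi * real k / real m - \<mu>)" for k
    by (simp add: w_def circle_point_def inner_complex_def cos_diff algebra_simps)
  have "real q - real p \<le> real m" using assms by auto
  then have "h \<le> pi * real m / real m"
    unfolding h_def using m by (intro divide_right_mono mult_left_mono) auto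
  then have h: "0 \<le> h" "h \<le> pi"
    using assms m by (auto simp: h_def)
  have abs: "\<bar>2 * pi * real k / real m - \<mu>\<bar> = pi * \<bar>2 * real k - (real p + real q)\<bar> / real m" for k
  proof -
    have "2 * pi * real k / real m - \<mu> = pi * (2 * real k - (real p + real q)) / real m"
      unfolding \<mu>_def diff_divide_distrib[symmetric] by (simp add: algebra_simps)
    then show ?thesis by (simp add: abs_mult)
  qed
  have out: "w \<bullet> circle_point m k \<le> cos h" if "k \<in> B" for k
  proof -
    define t where "t = \<bar>2 * pi * real k / real m - \<mu>\<bar>"
    have k: "1 \<le> k" "k \<le> m" "k \<le> p \<or> q \<le> k" using B that assms by auto
    have "real q - real p \<le> \<bar>2 * real k - (real p + real q)\<bar>" using k by auto
    then have 1: "h \<le> t"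
      unfolding t_def abs h_def using m by (intro divide_right_mono mult_left_mono) auto
    \<comment> \<open>The angle \<open>t\<close> is not reduced modulo \<open>2 * pi\<close>, so it
      must also stay \<open>h\<close> away from \<open>2 * pi\<close>; \<open>k = 1\<close> with
      \<open>q = m + 1\<close> is a tight case.\<close>
    have "\<bar>2 * real k - (real p + real q)\<bar> \<le> 2 * real m - (real q - real p)"
      using k assms by auto
    then have "t \<le> pi * (2 * real m - (real q - real p)) / real m"
      unfolding t_def abs using m by (intro divide_right_mono mult_left_mono) auto
    also have "\<dots> = 2 * pi - h" using m by (simp add: h_def field_simps)
    finally have 2: "t \<le> 2 * pi - h" .
    have "cos t \<le> cos h"
    proof (cases "t \<le> pi")
      case True
      then show ?thesis using 1 h by (intro cos_monotone_0_pi_le) auto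
    next
      case False
      then have "cos (2 * pi - t) \<le> cos h" using 2 h by (intro cos_monotone_0_pi_le) auto
      then show ?thesis by (simp add: cos_diff)
    qed
    then show ?thesis by (simp add: inner t_def)
  qed
  have ins: "w \<bullet> circle_point m k > cos h" if "k \<in> C" for k
  proof -
    have "p < k" "k < q" using C that by auto
    then have "\<bar>2 * real k - (real p + real q)\<bar> < real q - real p" by auto
    then have "\<bar>2 * pi * real k / real m - \<mu>\<bar> < h"
      unfolding abs h_def using m by (intro divide_strict_right_mono mult_strict_left_mono) auto
    then have "cos \<bar>2 * pi * real k / real m - \<mu>\<bar> > cos h"
      using h by (intro cos_monotone_0_pi) auto
    then show ?thesis by (simp add: inner)
  qed
  have "convex hull (circle_point m ` B) \<subseteq> {x. w \<bullet> x \<le> cos h}"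
    using out by (intro hull_minimal) (auto simp: convex_halfspace_le)
  moreover have "convex hull (circle_point m ` C) \<subseteq> {x. w \<bullet> x > cos h}"
    using ins by (intro hull_minimal) (auto simp: convex_halfspace_gt)
  ultimately show ?thesis by (fastforce simp: disjnt_iff)
qed

text \<open>The block \<open>X\<close> with the smaller minimum leaves gaps, and \<open>Y\<close>
  must lie in a single one: from the last point \<open>p\<close> of \<open>X\<close> before
  \<open>Min Y\<close> to the next point \<open>q\<close>, with \<open>q = m + 1\<close> if there is
  none. A point of \<open>Y\<close> beyond \<open>q\<close> would complete \<open>p\<close>,
  \<open>Min Y\<close>, \<open>q\<close> to a crossing.\<close>

lemma not_crossing_imp_disjnt_hulls:
  assumes "\<not> crossing B C" "B \<subseteq> {1..m}" "C \<subseteq> {1..m}" "B \<inter> C = {}"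
  shows "disjnt (convex hull (circle_point m ` B)) (convex hull (circle_point m ` C))"
proof (cases "B = {} \<or> C = {}")
  case True
  then show ?thesis by (auto simp: disjnt_def)
next
  case False
  have *: "disjnt (convex hull (circle_point m ` X)) (convex hull (circle_point m ` Y))"
    if X: "X \<subseteq> {1..m}" "X \<noteq> {}" and Y: "Y \<subseteq> {1..m}" "Y \<noteq> {}"
      and nc: "\<not> crossing X Y" and lt: "Min X < Min Y" and dis: "X \<inter> Y = {}" for X Y
  proof -
    have fin: "finite X" "finite Y" using X Y finite_subset by blast+
    define y where "y = Min Y"
    have y: "y \<in> Y" "\<And>k. k \<in> Y \<Longrightarrow> y \<le> k" using Y fin by (auto simp: y_def)
    define p where "p = Max {x \<in> X. x < y}"
    have "Min X \<in> {x \<in> X. x < y}" using X fin lt by (auto simp: y_def)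
    then have ne: "{x \<in> X. x < y} \<noteq> {}" by blast
    have "p \<in> {x \<in> X. x < y}" unfolding p_def by (rule Max_in) (use fin ne in auto)
    then have p: "p \<in> X" "p < y" by auto
    have pmax: "k \<le> p" if "k \<in> X" "k < y" for k
      unfolding p_def using that fin by (intro Max_ge) auto
    define q where "q = Min (insert (m + 1) {x \<in> X. y < x})"
    have qin: "q \<in> insert (m + 1) {x \<in> X. y < x}"
      unfolding q_def by (rule Min_in) (use fin in auto)
    have qmin: "q \<le> k" if "k \<in> X" "y < k" for k
      unfolding q_def using that fin by (intro Min_le) auto
    have qle: "q \<le> m + 1" "y < q" using qin X Y y by (auto simp: subset_iff)
    have "Y \<subseteq> {p<..<q}"
    proof
      fix k assume k: "k \<in> Y"
      have "k < q"
      proof (rule ccontr)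
        assume c: "\<not> k < q"
        then have "q \<in> X" using qin k Y by (auto simp: subset_iff)
        then have "q < k" using c k dis by (metis disjoint_iff linorder_neqE_nat)
        then have "crossing X Y"
          unfolding crossing_def using p y(1) qle(2) \<open>q \<in> X\<close> k by blast
        with nc show False ..
      qed
      then show "k \<in> {p<..<q}" using y(2)[OF k] p by auto
    qed
    moreover have "X \<subseteq> {1..p} \<union> {q..m}"
    proof
      fix k assume k: "k \<in> X"
      then have "k \<noteq> y" using y dis by auto
      then show "k \<in> {1..p} \<union> {q..m}"
        using k pmax[OF k] qmin[OF k] X by (cases "k < y") (auto simp: subset_iff)
    qed
    ultimately show ?thesis
      using p X qle by (intro disjnt_hulls_of_gap[of p q]) (auto simp: subset_iff)
  qed
  have fin: "finite B" "finite C" using assms finite_subset by blast+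
  have "Min B \<noteq> Min C" using False fin assms(4) by (metis Min_in disjoint_iff)
  then consider "Min B < Min C" | "Min C < Min B" by linarith
  then show ?thesis
  proof cases
    case 1
    then show ?thesis using assms False by (intro *) auto
  next
    case 2
    then have "disjnt (convex hull (circle_point m ` C)) (convex hull (circle_point m ` B))"
      using assms False by (intro *) (auto simp: crossing_commute)
    then show ?thesis by (rule disjnt_sym)
  qed
qed

text \<open>The geometry ends here: only the crossing pattern is used from now on.\<close>

lemma noncrossing_partitions_iff:
  "\<sigma> \<in> noncrossing_partitions m \<longleftrightarrow>
     partition_on {1..m} \<sigma> \<and> (\<forall>B\<in>\<sigma>. \<forall>C\<in>\<sigma>. B \<noteq> C \<longrightarrow> \<not> crossing B C)"
proof -
  have "disjnt (convex hull (circle_point m ` B)) (convex hull (circle_point m ` C)) \<longleftrightarrow> \<not> crossing B C"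
    if "partition_on {1..m} \<sigma>" "B \<in> \<sigma>" "C \<in> \<sigma>" "B \<noteq> C" for B C
  proof -
    have "B \<subseteq> {1..m}" "C \<subseteq> {1..m}" "B \<inter> C = {}"
      using that by (auto simp: partition_on_def disjoint_def)
    then show ?thesis
      using crossing_imp_hulls_meet not_crossing_imp_disjnt_hulls by metis
  qed
  then show ?thesis
    unfolding noncrossing_partitions_def pairwise_def by blast
qed

section \<open>Atoms of a product of posets\<close>

definition down_set :: "'a set \<Rightarrow> 'a rel \<Rightarrow> 'a \<Rightarrow> 'a set" where
  "down_set A r x = {y \<in> A. (y, x) \<in> r}"

text \<open>Stated through down sets because isomorphisms carry down sets to down sets, and in a
  product the down set of a pair is the product of the down sets. \<open>z\<close> is meant to be
  the least element.\<close>

definition is_atom :: "'a set \<Rightarrow> 'a rel \<Rightarrow> 'a \<Rightarrow> 'a \<Rightarrow> bool" where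
  "is_atom A r z x \<longleftrightarrow> x \<in> A \<and> x \<noteq> z \<and> down_set A r x = {z, x}"

text \<open>An element other than \<open>z\<close> with the smallest down set works: anything
  strictly below it, except \<open>z\<close>, would have a smaller one.\<close>

lemma exists_atom:
  assumes "finite P" "partial_order_on P R" "z \<in> P" "\<And>x. x \<in> P \<Longrightarrow> (z, x) \<in> R" "\<exists>x\<in>P. \<exists>y\<in>P. x \<noteq> y"
  shows "\<exists>a. is_atom P R z a"
proof -
  have refl: "\<And>x. x \<in> P \<Longrightarrow> (x, x) \<in> R" and tr: "trans R" and anti: "antisym R"
    using assms(2) by (auto simp: partial_order_on_def preorder_on_def refl_on_def)
  have "P - {z} \<noteq> {}" using assms(5) by blast
  then obtain x where x: "x \<in> P - {z}" by blast
  define a where "a = arg_min_on (\<lambda>x. card (down_set P R x)) (P - {z})"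
  have fin: "finite (down_set P R y)" for y
    unfolding down_set_def using assms(1) by simp
  have a: "a \<in> P - {z}" "\<And>y. y \<in> P - {z} \<Longrightarrow> card (down_set P R a) \<le> card (down_set P R y)"
    unfolding a_def using assms(1) x by (auto intro!: arg_min_least arg_min_if_finite simp del: Diff_iff)
  have "y = z \<or> y = a" if "y \<in> down_set P R a" for y
  proof (rule ccontr)
    assume ne: "\<not> (y = z \<or> y = a)"
    have y: "y \<in> P" "(y, a) \<in> R" using that by (auto simp: down_set_def)
    have "a \<notin> down_set P R y"
      using y ne anti by (auto simp: down_set_def dest: antisymD)
    moreover have "down_set P R y \<subseteq> down_set P R a"
      using y tr by (auto simp: down_set_def dest: transD)
    moreover have "a \<in> down_set P R a" using a refl by (auto simp: down_set_def)
    ultimately have "down_set P R y \<subset> down_set P R a" by blast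
    then have "card (down_set P R y) < card (down_set P R a)"
      using fin by (rule psubset_card_mono[rotated])
    with a(2)[of y] y ne show False by auto
  qed
  moreover have "z \<in> down_set P R a" "a \<in> down_set P R a"
    using a assms refl by (auto simp: down_set_def)
  ultimately show ?thesis
    using a unfolding is_atom_def by (intro exI[of _ a]) auto
qed

lemma down_set_prod_order:
  "down_set (P \<times> Q) (prod_order R S) (p, q) = down_set P R p \<times> down_set Q S q"
  by (auto simp: down_set_def prod_order_def)

text \<open>An atom of a product has exactly one coordinate that is not minimal; \<open>K\<close> records which.\<close>

lemma product_separates_atoms:
  fixes P :: "'p set" and Q :: "'q set" and L :: "'a set"
  assumes iso: "poset_isomorphic L r (P \<times> Q) (prod_order R S)"
    and L: "finite L" "z \<in> L" "\<And>x. x \<in> L \<Longrightarrow> (z, x) \<in> r"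
    and P: "partial_order_on P R" "\<exists>x\<in>P. \<exists>y\<in>P. x \<noteq> y"
    and Q: "partial_order_on Q S" "\<exists>x\<in>Q. \<exists>y\<in>Q. x \<noteq> y"
  obtains K where "\<exists>a. is_atom L r z a \<and> K a" "\<exists>b. is_atom L r z b \<and> \<not> K b"
    "\<And>a b. is_atom L r z a \<Longrightarrow> is_atom L r z b \<Longrightarrow> K a \<Longrightarrow> \<not> K b \<Longrightarrow>
       \<exists>c\<in>L. c \<noteq> z \<and> c \<noteq> a \<and> c \<noteq> b \<and> down_set L r c = {z, a, b, c}"
proof -
  from iso obtain f where f: "bij_betw f L (P \<times> Q)"
    and ord: "\<And>x y. x \<in> L \<Longrightarrow> y \<in> L \<Longrightarrow> (x, y) \<in> r \<longleftrightarrow> (f x, f y) \<in> prod_order R S"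
    unfolding poset_isomorphic_def by blast
  have inj: "inj_on f L" and img: "f ` L = P \<times> Q"
    using f by (auto simp: bij_betw_def)
  obtain p0 q0 where z: "f z = (p0, q0)" by fastforce
  have "f z \<in> P \<times> Q" using img L by blast
  then have p0: "p0 \<in> P" and q0: "q0 \<in> Q" using z by auto
  have "finite (P \<times> Q)" using img L(1) by (metis finite_imageI)
  then have fin: "finite P" "finite Q"
    using p0 q0 by (auto dest: finite_cartesian_productD1 finite_cartesian_productD2)
  have bot: "((p0, q0), w) \<in> prod_order R S" if "w \<in> P \<times> Q" for w
    using that img ord[OF L(2)] L(3) z by (metis imageE)
  have botP: "(p0, p) \<in> R" if "p \<in> P" for p
    using bot[of "(p, q0)"] that q0 by (auto simp: prod_order_def)
  have botQ: "(q0, q) \<in> S" if "q \<in> Q" for q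
    using bot[of "(p0, q)"] that p0 by (auto simp: prod_order_def)
  have reflP: "\<And>x. x \<in> P \<Longrightarrow> (x, x) \<in> R" and reflQ: "\<And>x. x \<in> Q \<Longrightarrow> (x, x) \<in> S"
    using P(1) Q(1) by (auto simp: partial_order_on_def preorder_on_def refl_on_def)
  have "down_set P R p0 = {p0}" "down_set Q S q0 = {q0}"
    using botP botQ P(1) Q(1) p0 q0
    by (auto simp: down_set_def partial_order_on_def preorder_on_def refl_on_def dest: antisymD)
  note bots = this
  have down: "f ` down_set L r x = down_set (P \<times> Q) (prod_order R S) (f x)" if "x \<in> L" for x
  proof
    show "f ` down_set L r x \<subseteq> down_set (P \<times> Q) (prod_order R S) (f x)"
      using ord[OF _ that] img by (auto simp: down_set_def)
    show "down_set (P \<times> Q) (prod_order R S) (f x) \<subseteq> f ` down_set L r x"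
    proof
      fix w assume w: "w \<in> down_set (P \<times> Q) (prod_order R S) (f x)"
      then have "w \<in> f ` L" unfolding img by (simp add: down_set_def)
      then obtain y where "y \<in> L" "w = f y" by blast
      then show "w \<in> f ` down_set L r x"
        using w ord[OF _ that] by (auto simp: down_set_def)
    qed
  qed
  have down_iff: "down_set L r x = X \<longleftrightarrow> down_set (P \<times> Q) (prod_order R S) (f x) = f ` X"
    if "x \<in> L" "X \<subseteq> L" for x X
    using inj_on_image_eq_iff[OF inj _ that(2), of "down_set L r x"] down[OF that(1)]
    by (auto simp: down_set_def)
  define K where "K = (\<lambda>x. snd (f x) = q0)"
  have atom: "\<exists>p. is_atom P R p0 p \<and> f x = (p, q0)" if at: "is_atom L r z x" "K x" for x
  proof -
    obtain p where p: "f x = (p, q0)" using at(2) by (cases "f x") (auto simp: K_def)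
    have x: "x \<in> L" "x \<noteq> z" "down_set L r x = {z, x}" using at(1) by (auto simp: is_atom_def)
    then have "f x \<noteq> f z" using inj L(2) by (auto dest: inj_onD)
    moreover have "down_set P R p \<times> {q0} = {(p0, q0), (p, q0)}"
      using x(3) down_iff[of x "{z, x}"] x(1) L(2) by (simp add: z p down_set_prod_order bots)
    then have "down_set P R p = {p0, p}" by auto
    moreover have "p \<in> P" using x(1) img p by force
    ultimately show ?thesis using z p by (auto simp: is_atom_def)
  qed
  have atom': "\<exists>q. is_atom Q S q0 q \<and> f x = (p0, q)" if at: "is_atom L r z x" "\<not> K x" for x
  proof -
    obtain p q where pq: "f x = (p, q)" "q \<noteq> q0" using at(2) by (cases "f x") (auto simp: K_def)
    have x: "x \<in> L" "x \<noteq> z" "down_set L r x = {z, x}" using at(1) by (auto simp: is_atom_def)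
    have pq': "p \<in> P" "q \<in> Q" using x(1) img pq by force+
    have eq: "down_set P R p \<times> down_set Q S q = {(p0, q0), (p, q)}"
      using x(3) down_iff[of x "{z, x}"] x(1) L(2) by (simp add: z pq down_set_prod_order)
    \<comment> \<open>\<open>(p, q0)\<close> lies below the image of the atom and differs from it
      since \<open>q\<close> is not \<open>q0\<close>; hence it is the least element.\<close>
    have "(p, q0) \<in> down_set P R p \<times> down_set Q S q"
      using pq' reflP botQ q0 by (auto simp: down_set_def)
    then have p: "p = p0" using eq pq(2) by auto
    then have "down_set Q S q = {q0, q}" using eq bots by auto
    then show ?thesis using pq p pq' by (auto simp: is_atom_def)
  qed
  show thesis
  proof (rule that[of K])
    obtain p where p: "is_atom P R p0 p" using exists_atom[OF fin(1) P(1) p0 botP P(2)] by blast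
    then have "(p, q0) \<in> f ` L" using img q0 by (auto simp: is_atom_def)
    then obtain a where a: "a \<in> L" "f a = (p, q0)" by (metis imageE)
    have "down_set L r a = {z, a}"
      using p L(2) a by (subst down_iff) (auto simp: z down_set_prod_order bots is_atom_def)
    then show "\<exists>a. is_atom L r z a \<and> K a"
      using a z p by (intro exI[of _ a]) (auto simp: is_atom_def K_def)
  next
    obtain q where q: "is_atom Q S q0 q" using exists_atom[OF fin(2) Q(1) q0 botQ Q(2)] by blast
    then have "(p0, q) \<in> f ` L" using img p0 by (auto simp: is_atom_def)
    then obtain a where a: "a \<in> L" "f a = (p0, q)" by (metis imageE)
    have "down_set L r a = {z, a}"
      using q L(2) a by (subst down_iff) (auto simp: z down_set_prod_order bots is_atom_def)
    then show "\<exists>b. is_atom L r z b \<and> \<not> K b"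
      using a z q by (intro exI[of _ a]) (auto simp: is_atom_def K_def)
  next
    fix a b assume ab: "is_atom L r z a" "is_atom L r z b" "K a" "\<not> K b"
    obtain p where p: "is_atom P R p0 p" "f a = (p, q0)" using atom ab by blast
    obtain q where q: "is_atom Q S q0 q" "f b = (p0, q)" using atom' ab by blast
    have "(p, q) \<in> f ` L" using img p q by (auto simp: is_atom_def)
    then obtain c where c: "c \<in> L" "f c = (p, q)" by (metis imageE)
    \<comment> \<open>The down set of \<open>(p, q)\<close> is \<open>{p0, p}\<close> times
      \<open>{q0, q}\<close>.\<close>
    have "down_set L r c = {z, a, b, c}"
      using p q c L(2) ab by (subst down_iff) (auto simp: z down_set_prod_order is_atom_def)
    moreover have "f c \<noteq> f z" "f c \<noteq> f a" "f c \<noteq> f b"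
      using p q c z by (auto simp: is_atom_def)
    ultimately show "\<exists>c\<in>L. c \<noteq> z \<and> c \<noteq> a \<and> c \<noteq> b \<and> down_set L r c = {z, a, b, c}"
      using c(1) by (intro bexI[of _ c]) auto
  qed
qed

section \<open>Partitions with one nontrivial block\<close>

definition one_block :: "'a set \<Rightarrow> 'a set \<Rightarrow> 'a set set" where
  "one_block A S = insert S ((\<lambda>x. {x}) ` (A - S))"

lemma partition_on_block_eq:
  "partition_on A \<sigma> \<Longrightarrow> B \<in> \<sigma> \<Longrightarrow> C \<in> \<sigma> \<Longrightarrow> x \<in> B \<Longrightarrow> x \<in> C \<Longrightarrow> B = C"
  by (auto simp: partition_on_def disjoint_def)

lemma partition_on_block_subset: "partition_on A \<sigma> \<Longrightarrow> B \<in> \<sigma> \<Longrightarrow> B \<subseteq> A"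
  by (auto simp: partition_on_def)

lemma one_block_singleton: "x \<in> A \<Longrightarrow> one_block A {x} = (\<lambda>x. {x}) ` A"
  by (auto simp: one_block_def)

lemma partition_on_one_block: "S \<subseteq> A \<Longrightarrow> S \<noteq> {} \<Longrightarrow> partition_on A (one_block A S)"
  by (auto simp: one_block_def partition_on_def disjoint_def)

lemma refines_one_block:
  assumes "partition_on A \<tau>" "B \<in> \<tau>" "S \<subseteq> B" "S \<noteq> {}"
  shows "refines A (one_block A S) \<tau>"
proof -
  have "S \<subseteq> A" using assms by (auto simp: partition_on_def)
  moreover have "\<exists>Y\<in>\<tau>. {x} \<subseteq> Y" if "x \<in> A" for x
    using that assms(1) by (auto simp: partition_on_def)
  ultimately show ?thesis
    using assms partition_on_one_block[of S A] unfolding refines_def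
    by (auto simp: one_block_def)
qed

lemma refines_one_block_mono:
  "S \<subseteq> T \<Longrightarrow> T \<subseteq> A \<Longrightarrow> S \<noteq> {} \<Longrightarrow> refines A (one_block A S) (one_block A T)"
  using refines_one_block[of A "one_block A T" T S] partition_on_one_block[of T A]
  by (auto simp: one_block_def)

lemma refines_singletons:
  "partition_on A \<tau> \<Longrightarrow> refines A ((\<lambda>x. {x}) ` A) \<tau>"
  unfolding refines_def using partition_on_singletons[of A] by (auto simp: partition_on_def)

lemma refines_top: "partition_on A \<sigma> \<Longrightarrow> A \<noteq> {} \<Longrightarrow> refines A \<sigma> {A}"
  unfolding refines_def by (auto simp: partition_on_space partition_on_def)

lemma card_one_block:
  assumes "finite A" "S \<noteq> {}"
  shows "card (one_block A S) = Suc (card (A - S))"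
proof -
  have "S \<notin> (\<lambda>x. {x}) ` (A - S)" by auto
  then show ?thesis
    using assms by (simp add: one_block_def card_image)
qed

text \<open>Two points in \<open>S\<close> are required because all one-point blocks give the same
  partition.\<close>

lemma one_block_inject:
  assumes "one_block A S = one_block A T" "x \<in> S" "y \<in> S" "x \<noteq> y"
  shows "S = T"
proof -
  have "S \<in> one_block A T" using assms(1) by (auto simp: one_block_def)
  then show ?thesis using assms by (auto simp: one_block_def)
qed

lemma one_block_noncrossing:
  assumes "S \<subseteq> {1..m}" "S \<noteq> {}"
  shows "one_block {1..m} S \<in> noncrossing_partitions m"
proof -
  have "\<not> crossing B {x}" "\<not> crossing {x} B" for B x
    by (auto simp: crossing_def)
  then show ?thesis
    using assms unfolding noncrossing_partitions_iff
    by (auto simp: partition_on_one_block) (auto simp: one_block_def)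
qed

text \<open>Sending each block of the finer partition to the block containing it is onto; with
  equally many blocks it is injective, so every coarse block has a single part. The number of blocks
  thus acts as a rank.\<close>

lemma
  assumes "finite A" "refines A \<sigma> \<tau>"
  shows card_le_of_refines: "card \<tau> \<le> card \<sigma>"
    and eq_of_refines_of_card_eq: "card \<sigma> = card \<tau> \<Longrightarrow> \<sigma> = \<tau>"
proof -
  have part: "partition_on A \<sigma>" "partition_on A \<tau>"
    using assms by (auto simp: refines_def)
  have fin: "finite \<sigma>" "finite \<tau>"
    using part assms(1) finite_elements by blast+
  obtain g where g: "\<And>X. X \<in> \<sigma> \<Longrightarrow> g X \<in> \<tau> \<and> X \<subseteq> g X"
    using assms(2) unfolding refines_def by metis
  have covers: "\<exists>X\<in>\<sigma>. g X = Y \<and> x \<in> X" if "Y \<in> \<tau>" "x \<in> Y" for Y x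
  proof -
    have "x \<in> A" using that part by (auto simp: partition_on_def)
    then obtain X where X: "X \<in> \<sigma>" "x \<in> X" using part by (auto simp: partition_on_def)
    then have "g X \<in> \<tau>" "x \<in> g X" using g by auto
    then have "g X = Y" using that part(2) by (auto simp: partition_on_def disjoint_def)
    with X show ?thesis by blast
  qed
  have img: "g ` \<sigma> = \<tau>"
  proof
    show "g ` \<sigma> \<subseteq> \<tau>" using g by auto
    show "\<tau> \<subseteq> g ` \<sigma>"
    proof
      fix Y assume Y: "Y \<in> \<tau>"
      then have "Y \<noteq> {}" using part by (auto simp: partition_on_def)
      then show "Y \<in> g ` \<sigma>" using covers[OF Y] by blast
    qed
  qed
  then show "card \<tau> \<le> card \<sigma>" using fin card_image_le by metis
  show "\<sigma> = \<tau>" if "card \<sigma> = card \<tau>"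
  proof -
    have inj: "inj_on g \<sigma>" using that img fin by (metis eq_card_imp_inj_on)
    have "g X = X" if "X \<in> \<sigma>" for X
    proof
      show "X \<subseteq> g X" using g that by blast
      show "g X \<subseteq> X"
        using covers[of "g X"] g inj that by (metis inj_onD subsetI)
    qed
    then show ?thesis using img by force
  qed
qed

lemma strictly_refines_trans:
  "strictly_refines m \<rho> \<sigma> \<Longrightarrow> strictly_refines m \<sigma> \<tau> \<Longrightarrow> strictly_refines m \<rho> \<tau>"
  unfolding strictly_refines_def by (metis refines_asym refines_trans)

lemma strictly_refines_asym: "strictly_refines m \<sigma> \<tau> \<Longrightarrow> \<not> strictly_refines m \<tau> \<sigma>"
  unfolding strictly_refines_def by (metis refines_asym)

lemma strictly_refines_one_block:
  assumes "S \<subset> T" "T \<subseteq> {1..m}" "S \<noteq> {}"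
  shows "strictly_refines m (one_block {1..m} S) (one_block {1..m} T)"
proof -
  have "{1..m} - T \<subset> {1..m} - S" using assms by blast
  then have "card ({1..m} - T) < card ({1..m} - S)" by (intro psubset_card_mono) auto
  then have "card (one_block {1..m} T) < card (one_block {1..m} S)"
    using assms by (subst (1 2) card_one_block) auto
  moreover have "refines {1..m} (one_block {1..m} S) (one_block {1..m} T)"
    using assms by (intro refines_one_block_mono) auto
  ultimately show ?thesis unfolding strictly_refines_def by auto
qed

section \<open>Maximal chains\<close>

lemma
  assumes "c \<in> maximal_chains m"
  shows maximal_chain_noncrossing: "set c \<subseteq> noncrossing_partitions m"
    and maximal_chain_less: "i < j \<Longrightarrow> j < length c \<Longrightarrow> strictly_refines m (c ! i) (c ! j)"
    and maximal_chain_extend: "\<And>\<rho>. \<rho> \<in> noncrossing_partitions m \<Longrightarrow>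
      (\<And>\<sigma>. \<sigma> \<in> set c \<Longrightarrow> \<sigma> = \<rho> \<or> strictly_refines m \<sigma> \<rho> \<or> strictly_refines m \<rho> \<sigma>) \<Longrightarrow> \<rho> \<in> set c"
proof -
  have max: "pred_on.maxchain (noncrossing_partitions m) (strictly_refines m) (set c)"
    and sorted: "sorted_wrt (strictly_refines m) c"
    using assms by (auto simp: maximal_chains_def)
  from max have chain: "pred_on.chain (noncrossing_partitions m) (strictly_refines m) (set c)"
    by (simp add: pred_on.maxchain_def)
  then show "set c \<subseteq> noncrossing_partitions m" by (simp add: pred_on.chain_def)
  show "strictly_refines m (c ! i) (c ! j)" if "i < j" "j < length c"
    using sorted that by (simp add: sorted_wrt_iff_nth_less)
  show "\<rho> \<in> set c" if "\<rho> \<in> noncrossing_partitions m"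
    "\<And>\<sigma>. \<sigma> \<in> set c \<Longrightarrow> \<sigma> = \<rho> \<or> strictly_refines m \<sigma> \<rho> \<or> strictly_refines m \<rho> \<sigma>" for \<rho>
  proof (rule ccontr)
    assume "\<rho> \<notin> set c"
    moreover have "pred_on.chain (noncrossing_partitions m) (strictly_refines m) (insert \<rho> (set c))"
      using chain that unfolding pred_on.chain_def by auto
    ultimately show False using max unfolding pred_on.maxchain_def by blast
  qed
qed

text \<open>An intermediate partition would be comparable with every member of the chain, hence
  belong to it by maximality, but no index is left for it.\<close>

lemma maximal_chain_no_between:
  assumes c: "c \<in> maximal_chains m" and i: "Suc i < length c"
    and \<rho>: "\<rho> \<in> noncrossing_partitions m" "strictly_refines m (c ! i) \<rho>" "refines {1..m} \<rho> (c ! Suc i)"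
  shows "\<rho> = c ! Suc i"
proof (rule ccontr)
  assume ne: "\<rho> \<noteq> c ! Suc i"
  then have less: "strictly_refines m \<rho> (c ! Suc i)" using \<rho> by (simp add: strictly_refines_def)
  have pos: "strictly_refines m (c ! k) \<rho> \<and> k \<le> i \<or> strictly_refines m \<rho> (c ! k) \<and> i < k"
    if "k < length c" for k
  proof (cases "k \<le> i")
    case True
    then show ?thesis
      using maximal_chain_less[OF c, of k i] strictly_refines_trans \<rho>(2) i by (cases "k = i") auto
  next
    case False
    then show ?thesis
      using maximal_chain_less[OF c, of "Suc i" k] strictly_refines_trans less that
      by (cases "k = Suc i") auto
  qed
  then have "\<rho> \<in> set c"
    by (intro maximal_chain_extend[OF c \<rho>(1)]) (metis in_set_conv_nth)
  then obtain k where "k < length c" "\<rho> = c ! k" by (metis in_set_conv_nth)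
  with pos[of k] show False using strictly_refines_asym by blast
qed

lemma maximal_chain_bottom:
  assumes c: "c \<in> maximal_chains m" and "1 \<le> m"
  shows "c \<noteq> []" "c ! 0 = (\<lambda>x. {x}) ` {1..m}"
proof -
  let ?z = "(\<lambda>x. {x}) ` {1..m}"
  have z: "?z \<in> noncrossing_partitions m"
    using one_block_noncrossing[of "{1}" m] assms(2) by (simp add: one_block_singleton)
  have le: "refines {1..m} ?z \<sigma>" if "\<sigma> \<in> noncrossing_partitions m" for \<sigma>
    using that by (intro refines_singletons) (simp add: noncrossing_partitions_iff)
  have "?z \<in> set c"
    using maximal_chain_noncrossing[OF c] le
    by (intro maximal_chain_extend[OF c z]) (auto simp: strictly_refines_def)
  then obtain k where k: "k < length c" "c ! k = ?z" by (metis in_set_conv_nth)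
  then show "c \<noteq> []" by auto
  have "k = 0"
  proof (rule ccontr)
    assume "k \<noteq> 0"
    then have "strictly_refines m (c ! 0) ?z" using maximal_chain_less[OF c, of 0 k] k by simp
    moreover have "refines {1..m} ?z (c ! 0)"
      using maximal_chain_noncrossing[OF c] \<open>c \<noteq> []\<close> by (intro le) (metis length_greater_0_conv nth_mem subsetD)
    ultimately show False by (metis refines_asym strictly_refines_def)
  qed
  with k show "c ! 0 = ?z" by simp
qed

lemma maximal_chain_top:
  assumes c: "c \<in> maximal_chains m" and "1 \<le> m"
  shows "{{1..m}} \<in> set c"
proof -
  have "one_block {1..m} {1..m} \<in> noncrossing_partitions m"
    using assms(2) by (intro one_block_noncrossing) auto
  then have t: "{{1..m}} \<in> noncrossing_partitions m" by (simp add: one_block_def)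
  have "refines {1..m} \<sigma> {{1..m}}" if "\<sigma> \<in> noncrossing_partitions m" for \<sigma>
    using that assms(2) by (intro refines_top) (auto simp: noncrossing_partitions_iff)
  then show ?thesis
    using maximal_chain_noncrossing[OF c]
    by (intro maximal_chain_extend[OF c t]) (auto simp: strictly_refines_def)
qed

text \<open>The only maximal chains that have to be built: one block absorbs the points in the order
  of \<open>xs\<close>. The first entry has a one-point block, so it is the discrete
  partition.\<close>

definition flag_chain :: "nat list \<Rightarrow> nat set set list" where
  "flag_chain xs = map (\<lambda>k. one_block (set xs) (set (take (Suc k) xs))) [0..<length xs]"

text \<open>The numbers of blocks run from \<open>m\<close> down to \<open>1\<close>, so a partition
  extending the chain is comparable with an entry that has as many blocks as itself, and therefore
  equals it.\<close>

lemma flag_chain_maximal: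
  assumes "distinct xs" "set xs = {1..m}" "xs \<noteq> []"
  shows "flag_chain xs \<in> maximal_chains m"
proof -
  let ?S = "\<lambda>k. set (take (Suc k) xs)"
  have len: "length xs = m" using assms by (metis card_atLeastAtMost diff_Suc_1 distinct_card)
  have nth: "flag_chain xs ! k = one_block {1..m} (?S k)" if "k < m" for k
    using that len assms(2) by (simp add: flag_chain_def)
  have lenc: "length (flag_chain xs) = m" using len by (simp add: flag_chain_def)
  have ne: "?S k \<noteq> {}" for k using assms by auto
  have sub: "?S k \<subseteq> {1..m}" for k using assms(2) by (metis set_take_subset)
  have card: "card (?S k) = Suc k" if "k < m" for k
    using that assms(1) len by (simp add: distinct_card)
  have less: "strictly_refines m (flag_chain xs ! i) (flag_chain xs ! j)" if "i < j" "j < m" for i j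
  proof -
    have "?S i \<subseteq> ?S j" using that by (intro set_take_subset_set_take) simp
    moreover have "?S i \<noteq> ?S j" using card[of i] card[of j] that by auto
    ultimately have "?S i \<subset> ?S j" by blast
    from strictly_refines_one_block[OF this sub ne] show ?thesis
      using that by (simp add: nth)
  qed
  have cardc: "card (flag_chain xs ! k) = m - k" if "k < m" for k
  proof -
    have "card ({1..m} - ?S k) = m - Suc k"
      using card[OF that] card_Diff_subset[OF _ sub[of k]] by simp
    then show ?thesis using that card_one_block[OF _ ne, of "{1..m}" k] by (simp add: nth)
  qed
  have NC: "set (flag_chain xs) \<subseteq> noncrossing_partitions m"
  proof
    fix \<sigma> assume "\<sigma> \<in> set (flag_chain xs)"
    then obtain k where "k < m" "\<sigma> = flag_chain xs ! k" using lenc by (metis in_set_conv_nth)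
    then show "\<sigma> \<in> noncrossing_partitions m"
      using one_block_noncrossing[OF sub ne] by (simp add: nth)
  qed
  have "pred_on.chain (noncrossing_partitions m) (strictly_refines m) (set (flag_chain xs))"
    unfolding pred_on.chain_def
  proof (intro conjI NC ballI)
    fix x y assume "x \<in> set (flag_chain xs)" "y \<in> set (flag_chain xs)"
    then obtain i j where "i < m" "j < m" "x = flag_chain xs ! i" "y = flag_chain xs ! j"
      using lenc by (metis in_set_conv_nth)
    then show "(strictly_refines m)\<^sup>=\<^sup>= x y \<or> (strictly_refines m)\<^sup>=\<^sup>= y x"
      using less[of i j] less[of j i] by (cases i j rule: linorder_cases) auto
  qed
  moreover have "\<not> set (flag_chain xs) \<subset> C"
    if C: "pred_on.chain (noncrossing_partitions m) (strictly_refines m) C" for C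
  proof
    assume psub: "set (flag_chain xs) \<subset> C"
    then obtain \<rho> where \<rho>: "\<rho> \<in> C" "\<rho> \<notin> set (flag_chain xs)" by blast
    have part: "partition_on {1..m} \<rho>"
      using C \<rho> by (auto simp: pred_on.chain_def noncrossing_partitions_iff)
    have m: "1 \<le> m" using len assms(3) by (cases xs) auto
    have "card {{1..m}} \<le> card \<rho>" "card \<rho> \<le> card ((\<lambda>x. {x}) ` {1..m})"
      using part m
      by (intro card_le_of_refines[of "{1..m}"] refines_top refines_singletons; simp)+
    then have "1 \<le> card \<rho>" "card \<rho> \<le> m" by (simp_all add: card_image)
    then have k: "m - card \<rho> < m" "card (flag_chain xs ! (m - card \<rho>)) = card \<rho>"
      using cardc[of "m - card \<rho>"] by auto
    define \<sigma> where "\<sigma> = flag_chain xs ! (m - card \<rho>)"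
    have \<sigma>: "\<sigma> \<in> set (flag_chain xs)" "card \<sigma> = card \<rho>"
      using k lenc by (auto simp: \<sigma>_def)
    then have "\<sigma> = \<rho> \<or> refines {1..m} \<sigma> \<rho> \<or> refines {1..m} \<rho> \<sigma>"
      using C \<rho> psub unfolding pred_on.chain_def strictly_refines_def by blast
    then have "\<sigma> = \<rho>"
      using \<sigma>(2) eq_of_refines_of_card_eq[of "{1..m}"] by force
    with \<sigma> \<rho> show False by simp
  qed
  ultimately show ?thesis
    unfolding maximal_chains_def pred_on.maxchain_def
    using less lenc by (auto simp: sorted_wrt_iff_nth_less)
qed

text \<open>If \<open>x\<close> lies below \<open>S\<close>, the block containing the minimum is
  \<open>{x}\<close> and the label is \<open>x\<close>. Otherwise it is \<open>S\<close>, and the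
  label is its largest element below \<open>x\<close>.\<close>

lemma cover_label_one_block:
  fixes A :: "nat set"
  assumes "finite A" "S \<subseteq> A" "S \<noteq> {}" "x \<in> A" "x \<notin> S"
  defines "l \<equiv> cover_label (one_block A S) (one_block A (insert x S))"
  shows "l \<in> S \<and> l < x \<or> l = x \<and> (\<forall>y\<in>S. x < y)"
proof -
  have part: "partition_on A (one_block A S)" using assms by (intro partition_on_one_block)
  have mem: "S \<in> one_block A S" "{x} \<in> one_block A S" "S \<noteq> {x}"
    using assms by (auto simp: one_block_def)
  have fin: "finite S" using assms finite_subset by blast
  have eq: "one_block A (insert x S) = insert (S \<union> {x}) (one_block A S - {S, {x}})"
    using assms by (auto simp: one_block_def)
  have eq': "one_block A (insert x S) = insert ({x} \<union> S) (one_block A S - {{x}, S})"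
    unfolding eq by (simp add: insert_commute)
  show ?thesis
  proof (cases "\<forall>y\<in>S. x < y")
    case True
    have "Min ({x} \<union> S) \<in> {x}"
      using True fin by (auto intro!: Min_eqI)
    then have "l = Max {y \<in> {x}. \<forall>z\<in>S. y < z}"
      unfolding l_def using mem eq' by (intro cover_label_eq[OF part]) auto
    also have "{y \<in> {x}. \<forall>z\<in>S. y < z} = {x}" using True by auto
    finally show ?thesis using True by simp
  next
    case False
    then obtain y where y: "y \<in> S" "y < x" using assms(5) by (metis linorder_neqE_nat)
    have "Min (S \<union> {x}) \<in> S \<union> {x}" using fin by (intro Min_in) auto
    moreover have "Min (S \<union> {x}) \<le> y" using fin y by (intro Min_le) auto
    ultimately have "Min (S \<union> {x}) \<in> S" using y by auto
    then have l: "l = Max {y \<in> S. \<forall>z\<in>{x}. y < z}"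
      unfolding l_def using mem eq by (intro cover_label_eq[OF part]) auto
    have "Max {y \<in> S. \<forall>z\<in>{x}. y < z} \<in> {y \<in> S. \<forall>z\<in>{x}. y < z}"
      using fin y by (intro Max_in) auto
    then show ?thesis unfolding l by auto
  qed
qed

lemma flag_chain_label:
  assumes "distinct xs" "Suc k < length xs"
  defines "S \<equiv> set (take (Suc k) xs)"
  shows "chain_labels (flag_chain xs) ! k \<in> S \<and> chain_labels (flag_chain xs) ! k < xs ! Suc k \<or>
    chain_labels (flag_chain xs) ! k = xs ! Suc k \<and> (\<forall>y\<in>S. xs ! Suc k < y)"
proof -
  have "take (Suc (Suc k)) xs = take (Suc k) xs @ [xs ! Suc k]"
    using assms(2) by (rule take_Suc_conv_app_nth)
  then have "set (take (Suc (Suc k)) xs) = insert (xs ! Suc k) S" by (simp add: S_def)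
  then have "chain_labels (flag_chain xs) ! k =
      cover_label (one_block (set xs) S) (one_block (set xs) (insert (xs ! Suc k) S))"
    using assms(2) less_diff_conv[of k "length xs" 1]
    by (simp add: chain_labels_def flag_chain_def S_def)
  moreover have "xs ! Suc k \<notin> S"
  proof
    assume "xs ! Suc k \<in> S"
    then obtain j where "j < Suc k" "xs ! j = xs ! Suc k"
      using assms(2) by (auto simp: S_def in_set_conv_nth)
    then show False using assms(1,2) by (simp add: nth_eq_iff_index_eq)
  qed
  moreover have "S \<subseteq> set xs" "S \<noteq> {}"
    using assms(2) by (auto simp: S_def dest: in_set_takeD)
  ultimately show ?thesis
    using cover_label_one_block[of "set xs" S "xs ! Suc k"] assms(2) by simp
qed

text \<open>If the entry at the 0-based index \<open>i\<close> of the sorted list exceeded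
  \<open>i + 1\<close>, so would all \<open>n - i\<close> entries from there on, one more than the
  count allows.\<close>

lemma parking_functionI:
  assumes "length a = n" "\<And>x. x \<in> set a \<Longrightarrow> 1 \<le> x"
    and count: "\<And>i. i \<le> n \<Longrightarrow> card {k. k < n \<and> i < a ! k} \<le> n - i"
  shows "a \<in> parking_functions n"
proof -
  have "sort a ! i \<le> i + 1" if i: "i < n" for i
  proof (rule ccontr)
    assume big: "\<not> sort a ! i \<le> i + 1"
    have "i + 1 < sort a ! k" if "k \<in> {i..<n}" for k
    proof -
      have "sort a ! i \<le> sort a ! k" using that assms(1) by (intro sorted_nth_mono) auto
      then show ?thesis using big by simp
    qed
    then have "{i..<n} \<subseteq> {k. k < n \<and> i + 1 < sort a ! k}" by auto
    then have "card {i..<n} \<le> card {k. k < n \<and> i + 1 < sort a ! k}"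
      by (intro card_mono) auto
    also have "\<dots> = length (filter (\<lambda>y. i + 1 < y) (sort a))"
      using assms(1) by (simp add: length_filter_conv_card)
    also have "\<dots> = length (filter (\<lambda>y. i + 1 < y) a)"
      by (simp add: filter_sort)
    also have "\<dots> = card {k. k < n \<and> i + 1 < a ! k}"
      using assms(1) by (simp add: length_filter_conv_card)
    also have "\<dots> \<le> n - (i + 1)" using i by (intro count) simp
    finally show False using i by simp
  qed
  then show ?thesis using assms by (simp add: parking_functions_def)
qed

text \<open>Every label exceeding \<open>i\<close> comes from adding a point exceeding \<open>i\<close> which is not the first
  such point.\<close>

lemma flag_chain_labels_parking:
  assumes "distinct xs" "set xs = {1..n + 1}"
  shows "chain_labels (flag_chain xs) \<in> parking_functions n"
proof (rule parking_functionI)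
  let ?a = "chain_labels (flag_chain xs)"
  have len: "length xs = n + 1" using assms by (metis card_atLeastAtMost diff_Suc_1 distinct_card)
  show lena: "length ?a = n" using len by (simp add: chain_labels_def flag_chain_def)
  note lab = flag_chain_label[OF assms(1)]
  have S: "set (take k xs) \<subseteq> {1..n + 1}" for k using assms(2) by (metis set_take_subset)
  have x: "xs ! k \<in> {1..n + 1}" if "k < n + 1" for k using assms(2) len that by (metis nth_mem)
  show "1 \<le> l" if l: "l \<in> set ?a" for l
  proof -
    obtain k where k: "k < n" "l = ?a ! k" using l lena by (metis in_set_conv_nth)
    then have "l \<in> set (take (Suc k) xs) \<or> l = xs ! Suc k" using lab[of k] len by auto
    then have "l \<in> {1..n + 1}" using S[of "Suc k"] x[of "Suc k"] k(1) by (auto simp: subset_iff)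
    then show ?thesis by simp
  qed
  show "card {k. k < n \<and> i < ?a ! k} \<le> n - i" if i: "i \<le> n" for i
  proof -
    let ?K = "{k. k < n \<and> i < ?a ! k}"
    define U where "U = {j. j < n + 1 \<and> i < xs ! j}"
    have finU: "finite U" by (simp add: U_def)
    have "bij_betw ((!) xs) U {i<..n + 1}"
    proof (rule bij_betw_imageI)
      show "inj_on ((!) xs) U"
        using assms(1) len by (auto simp: U_def inj_on_def nth_eq_iff_index_eq)
      show "(!) xs ` U = {i<..n + 1}"
      proof
        show "(!) xs ` U \<subseteq> {i<..n + 1}" using x by (auto simp: U_def)
        show "{i<..n + 1} \<subseteq> (!) xs ` U"
        proof
          fix y assume y: "y \<in> {i<..n + 1}"
          then have "y \<in> set xs" using assms(2) by auto
          then obtain j where "j < n + 1" "xs ! j = y" using len by (metis in_set_conv_nth)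
          then show "y \<in> (!) xs ` U" using y by (auto simp: U_def)
        qed
      qed
    qed
    then have cardU: "card U = n + 1 - i" by (simp add: bij_betw_same_card)
    have K: "Suc k \<in> U \<and> (\<exists>j\<in>U. j < Suc k)" if "k \<in> ?K" for k
    proof -
      have k: "Suc k < length xs" "i < ?a ! k" using that len by auto
      have "i < xs ! Suc k \<and> (\<exists>y\<in>set (take (Suc k) xs). i < y)"
      proof (cases "?a ! k \<in> set (take (Suc k) xs) \<and> ?a ! k < xs ! Suc k")
        case True
        then show ?thesis using k(2) by auto
      next
        case False
        then have *: "?a ! k = xs ! Suc k" "\<forall>y\<in>set (take (Suc k) xs). xs ! Suc k < y"
          using lab[OF k(1)] by auto
        \<comment> \<open>The new point is a new minimum and exceeds \<open>i\<close>, so every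
          earlier point, in particular the first, exceeds \<open>i\<close> as well.\<close>
        have "xs ! 0 \<in> set (take (Suc k) xs)" using k(1) by (cases xs) auto
        then show ?thesis using * k(2) by (metis less_trans)
      qed
      then obtain y where y: "i < xs ! Suc k" "y \<in> set (take (Suc k) xs)" "i < y" by blast
      from y(2) obtain j where j: "j < Suc k" "xs ! j = y"
        using k(1) by (auto simp: in_set_conv_nth)
      then have "j \<in> U" using k(1) len y(3) by (simp add: U_def)
      moreover have "Suc k \<in> U" using k(1) len y(1) by (simp add: U_def)
      ultimately show ?thesis using j(1) by blast
    qed
    show ?thesis
    proof (cases "?K = {}")
      case True
      then show ?thesis by (metis card.empty le0)
    next
      case False
      then have "U \<noteq> {}" using K by blast
      then have Min: "Min U \<in> U" using finU by simp
      have "Suc ` ?K \<subseteq> U - {Min U}"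
      proof
        fix s assume "s \<in> Suc ` ?K"
        then obtain k where k: "k \<in> ?K" "s = Suc k" by blast
        then obtain j where "j \<in> U" "j < Suc k" using K by blast
        then have "Min U < Suc k" using finU by (meson Min_le le_less_trans)
        then show "s \<in> U - {Min U}" using K k by auto
      qed
      then have "card (Suc ` ?K) \<le> card (U - {Min U})" using finU by (intro card_mono) auto
      also have "\<dots> = n - i" using Min finU cardU by simp
      finally show ?thesis by (simp add: card_image)
    qed
  qed
qed

abbreviation singletons :: "nat \<Rightarrow> nat set set" where
  "singletons n \<equiv> (\<lambda>x. {x}) ` {1..n + 1}"

abbreviation single_block :: "nat \<Rightarrow> nat set \<Rightarrow> nat set set" where
  "single_block n \<equiv> one_block {1..n + 1}"

section \<open>The order of the poset of a set of parking functions\<close>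

lemma pf_covers_no_between:
  assumes "(\<sigma>, \<tau>) \<in> pf_covers n X"
    "\<rho> \<in> noncrossing_partitions (n + 1)" "strictly_refines (n + 1) \<sigma> \<rho>" "refines {1..n + 1} \<rho> \<tau>"
  shows "\<rho> = \<tau>"
  using assms maximal_chain_no_between unfolding pf_covers_def pf_chains_def by blast

lemma pf_covers_less:
  assumes "(\<sigma>, \<tau>) \<in> pf_covers n X"
  shows "strictly_refines (n + 1) \<sigma> \<tau>"
proof -
  obtain c i where "c \<in> maximal_chains (n + 1)" "Suc i < length c" "\<sigma> = c ! i" "\<tau> = c ! Suc i"
    using assms by (auto simp: pf_covers_def pf_chains_def)
  then show ?thesis using maximal_chain_less[of c "n + 1" i "Suc i"] by simp
qed

lemma pf_covers_in_poset:
  assumes "(\<sigma>, \<tau>) \<in> pf_covers n X"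
  shows "\<sigma> \<in> pf_poset n X" "\<tau> \<in> pf_poset n X"
  using assms unfolding pf_covers_def pf_poset_def by (auto, (meson Suc_lessD nth_mem)+)

lemma pf_covers_in_order: "(\<sigma>, \<tau>) \<in> pf_covers n X \<Longrightarrow> (\<sigma>, \<tau>) \<in> pf_order n X"
  using pf_covers_in_poset[of \<sigma> \<tau>] by (auto simp: pf_order_def)

lemma pf_poset_noncrossing: "pf_poset n X \<subseteq> noncrossing_partitions (n + 1)"
  unfolding pf_poset_def pf_chains_def using maximal_chain_noncrossing by blast

lemma pf_poset_partition_on: "\<sigma> \<in> pf_poset n X \<Longrightarrow> partition_on {1..n + 1} \<sigma>"
  using pf_poset_noncrossing[of n X] noncrossing_partitions_iff[of \<sigma> "n + 1"] by (auto dest: subsetD)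

lemma finite_pf_poset: "finite (pf_poset n X)"
proof (rule finite_subset)
  show "pf_poset n X \<subseteq> {\<sigma>. partition_on {1..n + 1} \<sigma>}"
    using pf_poset_partition_on by blast
qed (simp add: finitely_many_partition_on)

lemma pf_order_refines:
  assumes "(\<sigma>, \<tau>) \<in> pf_order n X"
  shows "refines {1..n + 1} \<sigma> \<tau>"
proof -
  have "\<sigma> \<in> noncrossing_partitions (n + 1)" "(\<sigma>, \<tau>) \<in> (pf_covers n X)\<^sup>*"
    using assms pf_poset_noncrossing by (auto simp: pf_order_def)
  from this(2,1) show ?thesis
  proof (induction rule: rtrancl_induct)
    case base
    then show ?case by (simp add: noncrossing_partitions_iff refines_refl)
  next
    case (step \<rho> \<tau>)
    then show ?case
      using pf_covers_less[OF step.hyps(2)] refines_trans by (metis strictly_refines_def)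
  qed
qed

lemma pf_order_last_cover:
  assumes "(\<sigma>, \<tau>) \<in> pf_order n X" "\<sigma> \<noteq> \<tau>"
  obtains \<rho> where "(\<sigma>, \<rho>) \<in> pf_order n X" "(\<rho>, \<tau>) \<in> pf_covers n X"
proof -
  have "(\<sigma>, \<tau>) \<in> (pf_covers n X)\<^sup>*" "\<sigma> \<in> pf_poset n X"
    using assms(1) by (auto simp: pf_order_def)
  then obtain \<rho> where \<rho>: "(\<sigma>, \<rho>) \<in> (pf_covers n X)\<^sup>*" "(\<rho>, \<tau>) \<in> pf_covers n X"
    using assms(2) by (metis rtranclE)
  then show thesis
    using that \<open>\<sigma> \<in> pf_poset n X\<close> pf_covers_in_poset[OF \<rho>(2)] by (simp add: pf_order_def)
qed

lemma singletons_least: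
  assumes "\<sigma> \<in> pf_poset n X"
  shows "singletons n \<in> pf_poset n X" "(singletons n, \<sigma>) \<in> pf_order n X"
proof -
  obtain c where c: "c \<in> pf_chains n X" "\<sigma> \<in> set c" using assms by (auto simp: pf_poset_def)
  then have max: "c \<in> maximal_chains (n + 1)" by (simp add: pf_chains_def)
  have bot: "c \<noteq> []" "c ! 0 = singletons n" using maximal_chain_bottom[OF max] by auto
  then show L: "singletons n \<in> pf_poset n X"
    using c(1) unfolding pf_poset_def by (metis UN_I length_greater_0_conv nth_mem)
  obtain k where k: "k < length c" "\<sigma> = c ! k" using c(2) by (metis in_set_conv_nth)
  have "(c ! 0, c ! k) \<in> (pf_covers n X)\<^sup>*" if "k < length c" for k
    using that
  proof (induction k)
    case (Suc k)
    then have "(c ! k, c ! Suc k) \<in> pf_covers n X" using c(1) by (auto simp: pf_covers_def)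
    with Suc show ?case by (meson Suc_lessD rtrancl.rtrancl_into_rtrancl)
  qed simp
  then show "(singletons n, \<sigma>) \<in> pf_order n X"
    using k bot L assms by (auto simp: pf_order_def)
qed

section \<open>Atoms and their common covers\<close>

abbreviation pf_atom :: "nat \<Rightarrow> nat list set \<Rightarrow> nat set set \<Rightarrow> bool" where
  "pf_atom n X \<equiv> is_atom (pf_poset n X) (pf_order n X) (singletons n)"

text \<open>Forwards: the last cover on a path from the discrete partition to the atom can only
  start at the discrete partition. Backwards: anything below \<open>\<alpha>\<close> in this order
  refines it, so it would lie between the two members of a cover.\<close>

lemma pf_atom_iff: "pf_atom n X \<alpha> \<longleftrightarrow> (singletons n, \<alpha>) \<in> pf_covers n X"
proof
  assume "pf_atom n X \<alpha>"
  then have \<alpha>: "\<alpha> \<in> pf_poset n X" "\<alpha> \<noteq> singletons n"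
    "down_set (pf_poset n X) (pf_order n X) \<alpha> = {singletons n, \<alpha>}"
    by (auto simp: is_atom_def)
  have "(singletons n, \<alpha>) \<in> pf_order n X" using singletons_least(2)[OF \<alpha>(1)] .
  then obtain \<rho> where \<rho>: "(singletons n, \<rho>) \<in> pf_order n X" "(\<rho>, \<alpha>) \<in> pf_covers n X"
    using \<alpha>(2) pf_order_last_cover by metis
  then have "\<rho> \<in> down_set (pf_poset n X) (pf_order n X) \<alpha>"
    using pf_covers_in_order pf_covers_in_poset by (simp add: down_set_def)
  moreover have "\<rho> \<noteq> \<alpha>" using pf_covers_less[OF \<rho>(2)] by (simp add: strictly_refines_def)
  ultimately show "(singletons n, \<alpha>) \<in> pf_covers n X" using \<alpha>(3) \<rho>(2) by auto
next
  assume cov: "(singletons n, \<alpha>) \<in> pf_covers n X"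
  note L = pf_covers_in_poset[OF cov]
  have "\<rho> \<in> {singletons n, \<alpha>}" if \<rho>: "\<rho> \<in> pf_poset n X" "(\<rho>, \<alpha>) \<in> pf_order n X" for \<rho>
  proof (cases "\<rho> = singletons n")
    case False
    then have "strictly_refines (n + 1) (singletons n) \<rho>"
      using pf_order_refines[OF singletons_least(2)[OF \<rho>(1)]] by (simp add: strictly_refines_def)
    then have "\<rho> = \<alpha>"
      using pf_covers_no_between[OF cov] \<rho> pf_poset_noncrossing pf_order_refines by blast
    then show ?thesis by simp
  qed simp
  moreover have "(\<alpha>, \<alpha>) \<in> pf_order n X" using L by (simp add: pf_order_def)
  ultimately have "down_set (pf_poset n X) (pf_order n X) \<alpha> = {singletons n, \<alpha>}"
    using L pf_covers_in_order[OF cov] by (auto simp: down_set_def)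
  then show "pf_atom n X \<alpha>"
    using L pf_covers_less[OF cov] by (auto simp: is_atom_def strictly_refines_def)
qed

text \<open>Some block has two points. The partition that joins only these two lies strictly above
  the discrete one and refines \<open>\<alpha>\<close>, so the cover forces equality.\<close>

lemma pf_atom_is_pair:
  assumes "pf_atom n X \<alpha>"
  obtains i j where "1 \<le> i" "i < j" "j \<le> n + 1" "\<alpha> = single_block n {i, j}"
proof -
  have cov: "(singletons n, \<alpha>) \<in> pf_covers n X" using assms pf_atom_iff by blast
  have part: "partition_on {1..n + 1} \<alpha>"
    using pf_covers_in_poset(2)[OF cov] by (rule pf_poset_partition_on)
  have "\<exists>B\<in>\<alpha>. \<exists>x\<in>B. \<exists>y\<in>B. x \<noteq> y"
  proof (rule ccontr)
    assume *: "\<not> (\<exists>B\<in>\<alpha>. \<exists>x\<in>B. \<exists>y\<in>B. x \<noteq> y)"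
    have "refines {1..n + 1} \<alpha> (singletons n)"
      unfolding refines_def
    proof (intro conjI part partition_on_singletons ballI)
      fix B assume B: "B \<in> \<alpha>"
      then have "B \<noteq> {}" using part by (auto simp: partition_on_def)
      then obtain x where x: "x \<in> B" by blast
      then have "B = {x}" using * B by blast
      moreover have "x \<in> {1..n + 1}" using x B part by (auto simp: partition_on_def)
      ultimately show "\<exists>Y\<in>singletons n. B \<subseteq> Y" by blast
    qed
    then show False
      using pf_covers_less[OF cov] by (metis refines_asym strictly_refines_def)
  qed
  then obtain B x y where B: "B \<in> \<alpha>" "x \<in> B" "y \<in> B" "x \<noteq> y" by blast
  define i j where "i = min x y" and "j = max x y"
  have ij: "i < j" "{i, j} \<subseteq> B" using B by (auto simp: i_def j_def min_def max_def)
  have "B \<subseteq> {1..n + 1}" using B part by (auto simp: partition_on_def)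
  then have ij': "{i, j} \<subseteq> {1..n + 1}" using ij by blast
  have "single_block n {i, j} = \<alpha>"
  proof (rule pf_covers_no_between[OF cov])
    show "single_block n {i, j} \<in> noncrossing_partitions (n + 1)"
      using ij' by (intro one_block_noncrossing) auto
    have "strictly_refines (n + 1) (single_block n {i}) (single_block n {i, j})"
      using ij ij' by (intro strictly_refines_one_block) auto
    then show "strictly_refines (n + 1) (singletons n) (single_block n {i, j})"
      using ij' by (simp add: one_block_singleton)
    show "refines {1..n + 1} (single_block n {i, j}) \<alpha>"
      using ij B by (intro refines_one_block[OF part B(1)]) auto
  qed
  then show thesis using that ij ij' by auto
qed

text \<open>The shared point \<open>x\<close> forces all three points into one block of
  \<open>\<tau>\<close>, so the partition with block \<open>{x, y, w}\<close> lies between a pair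
  and its cover.\<close>

lemma common_cover_of_pairs:
  assumes "x \<noteq> y" "x \<noteq> w" "y \<noteq> w" "{x, y, w} \<subseteq> {1..n + 1}"
    and cov: "(single_block n {x, y}, \<tau>) \<in> pf_covers n X" "(single_block n {x, w}, \<tau>) \<in> pf_covers n X"
  shows "\<tau> = single_block n {x, y, w}"
proof -
  have ref: "refines {1..n + 1} (single_block n {x, y}) \<tau>" "refines {1..n + 1} (single_block n {x, w}) \<tau>"
    using cov[THEN pf_covers_less] by (auto simp: strictly_refines_def)
  then have part: "partition_on {1..n + 1} \<tau>" by (simp add: refines_def)
  obtain B C where BC: "B \<in> \<tau>" "{x, y} \<subseteq> B" "C \<in> \<tau>" "{x, w} \<subseteq> C"
    using ref unfolding refines_def one_block_def by blast
  then have "B = C" using part by (auto simp: partition_on_def disjoint_def)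
  then have "refines {1..n + 1} (single_block n {x, y, w}) \<tau>"
    using BC by (intro refines_one_block[OF part BC(1)]) auto
  moreover have "strictly_refines (n + 1) (single_block n {x, y}) (single_block n {x, y, w})"
    using assms by (intro strictly_refines_one_block) auto
  moreover have "single_block n {x, y, w} \<in> noncrossing_partitions (n + 1)"
    using assms by (intro one_block_noncrossing) auto
  ultimately have "single_block n {x, y, w} = \<tau>" using pf_covers_no_between[OF cov(1)] by blast
  then show ?thesis ..
qed

text \<open>A path from \<open>\<alpha>\<close> to \<open>c\<close> ends in a cover that starts at
  an element of the down set; among the four, only \<open>\<alpha>\<close> is above
  \<open>\<alpha>\<close> and strictly below \<open>c\<close>.\<close>

lemma covers_of_diamond:
  assumes "pf_atom n X \<alpha>" "pf_atom n X \<beta>" "\<alpha> \<noteq> \<beta>"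
    "c \<noteq> \<alpha>" "down_set (pf_poset n X) (pf_order n X) c = {singletons n, \<alpha>, \<beta>, c}"
  shows "(\<alpha>, c) \<in> pf_covers n X"
proof -
  have "(\<alpha>, c) \<in> pf_order n X" using assms(5) by (auto simp: down_set_def)
  then obtain \<rho> where \<rho>: "(\<alpha>, \<rho>) \<in> pf_order n X" "(\<rho>, c) \<in> pf_covers n X"
    using assms(4) pf_order_last_cover by metis
  have ne: "\<rho> \<noteq> c" using pf_covers_less[OF \<rho>(2)] by (simp add: strictly_refines_def)
  have "\<rho> \<in> down_set (pf_poset n X) (pf_order n X) c"
    using \<rho>(2) pf_covers_in_order pf_covers_in_poset by (simp add: down_set_def)
  then have "\<rho> \<in> {singletons n, \<alpha>, \<beta>}" using ne assms(5) by auto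
  moreover have "\<rho> \<noteq> singletons n"
  proof
    assume "\<rho> = singletons n"
    then have "\<alpha> = singletons n"
      using pf_order_refines[OF \<rho>(1)] assms(1) pf_covers_less[of "singletons n" \<alpha>]
      unfolding pf_atom_iff by (metis refines_asym strictly_refines_def)
    then show False using assms(1) by (simp add: is_atom_def)
  qed
  moreover have "\<rho> \<noteq> \<beta>"
  proof
    assume "\<rho> = \<beta>"
    then have "\<alpha> \<in> down_set (pf_poset n X) (pf_order n X) \<beta>"
      using \<rho>(1) assms(1) by (simp add: down_set_def is_atom_def)
    then show False using assms(1-3) by (auto simp: is_atom_def)
  qed
  ultimately show ?thesis using \<rho>(2) by auto
qed

section \<open>Parking functions without the maximal entry\<close>

text \<open>A label \<open>n\<close> would need \<open>n + 1\<close> to join a block containing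
  \<open>n\<close>, or \<open>n\<close> to join the block \<open>{n + 1}\<close>. The former fails
  because \<open>n + 1\<close> is among the first three points and \<open>n\<close> comes after
  them, the latter because the block already has several points when \<open>n\<close>
  arrives.\<close>

lemma flag_chain_without_max:
  assumes xs: "distinct (x # y # w # xs)" "set (x # y # w # xs) = {1..n + 1}"
    and "n \<notin> {x, y, w}" "n + 1 \<in> {x, y, w}"
  shows "flag_chain (x # y # w # xs) \<in> pf_chains n (parking_functions_without_max n)"
proof -
  let ?xs = "x # y # w # xs" and ?a = "chain_labels (flag_chain (x # y # w # xs))"
  have len: "length ?a = n" using flag_chain_labels_parking[OF xs] by (simp add: parking_functions_def)
  have len': "length ?xs = n + 1" using xs by (metis card_atLeastAtMost diff_Suc_1 distinct_card)
  have "n \<notin> set ?a"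
  proof
    assume "n \<in> set ?a"
    then obtain k where k: "k < n" "?a ! k = n" using len by (metis in_set_conv_nth)
    then have k': "Suc k < length ?xs" using len' by simp
    have "n \<in> set (take (Suc k) ?xs) \<and> n < ?xs ! Suc k \<or>
        n = ?xs ! Suc k \<and> (\<forall>v\<in>set (take (Suc k) ?xs). n < v)"
      using flag_chain_label[OF xs(1) k'] k(2) by metis
    moreover have "?xs ! Suc k \<in> {1..n + 1}" using xs(2) k' by (metis nth_mem)
    moreover have "set (take (Suc k) ?xs) \<subseteq> {1..n + 1}" using xs(2) by (metis set_take_subset)
    ultimately consider "n \<in> set (take (Suc k) ?xs)" "?xs ! Suc k = n + 1"
      | "?xs ! Suc k = n" "set (take (Suc k) ?xs) \<subseteq> {n + 1}"
      by (fastforce simp: subset_iff)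
    then show False
    proof cases
      case 1
      have "n + 1 \<notin> set xs" using xs(1) assms(4) by auto
      moreover have "2 \<le> k \<Longrightarrow> ?xs ! Suc k \<in> set xs" using k' by (auto simp: nth_Cons' )
      ultimately have "k < 2" using 1(2) by (metis not_le)
      then have "n \<in> {x, y}" using 1(1) by (cases k) (auto simp: numeral_2_eq_2 split: if_splits)
      then show False using assms(3) by auto
    next
      case 2
      have "k \<noteq> 0" using 2(1) assms(3) by (cases k) auto
      then have "{x, y} \<subseteq> set (take (Suc k) ?xs)" by (cases k) auto
      then have "x = y" using 2(2) by auto
      then show False using xs(1) by simp
    qed
  qed
  then show ?thesis
    using flag_chain_maximal[OF xs] flag_chain_labels_parking[OF xs]
    by (simp add: pf_chains_def parking_functions_without_max_def)
qed

text \<open>The hypotheses are symmetric in the three points, so by permuting them each of the three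
  pairs becomes an atom covered by the triangle.\<close>

lemma triangle_covers:
  assumes "x \<noteq> y" "x \<noteq> w" "y \<noteq> w" "{x, y, w} \<subseteq> {1..n + 1}"
    and "n \<notin> {x, y, w}" "n + 1 \<in> {x, y, w}"
  shows "(singletons n, single_block n {x, y}) \<in> pf_covers n (parking_functions_without_max n)"
    and "(single_block n {x, y}, single_block n {x, y, w}) \<in> pf_covers n (parking_functions_without_max n)"
proof -
  \<comment> \<open>After the first three points any order would do.\<close>
  define xs where "xs = x # y # w # sorted_list_of_set ({1..n + 1} - {x, y, w})"
  have xs: "distinct xs" "set xs = {1..n + 1}" using assms(1-4) by (auto simp: xs_def)
  define c where "c = flag_chain xs"
  have c: "c \<in> pf_chains n (parking_functions_without_max n)"
    using xs assms unfolding c_def xs_def by (intro flag_chain_without_max) auto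
  have len: "length c = length xs" "2 < length xs" by (simp_all add: c_def flag_chain_def xs_def)
  have nth: "c ! k = single_block n (set (take (Suc k) xs))" if "k < length xs" for k
    using that xs(2) by (simp add: c_def flag_chain_def)
  have eqs: "c ! 0 = single_block n {x}" "c ! Suc 0 = single_block n {x, y}" "c ! Suc (Suc 0) = single_block n {x, y, w}"
    using len(2) by (subst nth; simp add: xs_def)+
  have cov: "(c ! k, c ! Suc k) \<in> pf_covers n (parking_functions_without_max n)" if "Suc k < length c" for k
    using c that by (auto simp: pf_covers_def)
  have "single_block n {x} = singletons n" using assms(4) by (intro one_block_singleton) auto
  then show "(singletons n, single_block n {x, y}) \<in> pf_covers n (parking_functions_without_max n)"
    using cov[of 0] len eqs by simp
  show "(single_block n {x, y}, single_block n {x, y, w}) \<in> pf_covers n (parking_functions_without_max n)"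
    using cov[of "Suc 0"] len eqs by simp
qed

text \<open>In \<open>\<tau>\<close> the block of \<open>n + 1\<close> must contain \<open>1\<close> and \<open>n\<close>, as it would otherwise cross their block.\<close>

lemma cover_label_joining_max:
  assumes NC: "\<sigma> \<in> noncrossing_partitions (n + 1)" "\<tau> \<in> noncrossing_partitions (n + 1)"
    and ref: "refines {1..n + 1} \<sigma> \<tau>"
    and no_between: "\<And>\<rho>. \<rho> \<in> noncrossing_partitions (n + 1) \<Longrightarrow> strictly_refines (n + 1) \<sigma> \<rho> \<Longrightarrow>
      refines {1..n + 1} \<rho> \<tau> \<Longrightarrow> \<rho> = \<tau>"
    and single: "{n + 1} \<in> \<sigma>" "{n + 1} \<notin> \<tau>"
    and B: "B \<in> \<sigma>" "1 \<in> B" "n \<in> B"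
    and n: "1 \<le> n"
  shows "cover_label \<sigma> \<tau> = n"
proof -
  have part: "partition_on {1..n + 1} \<sigma>" "partition_on {1..n + 1} \<tau>"
    using NC by (auto simp: noncrossing_partitions_iff)
  obtain E where E: "E \<in> \<tau>" "B \<subseteq> E" using ref B(1) by (auto simp: refines_def)
  obtain D where D: "D \<in> \<tau>" "n + 1 \<in> D" using ref single(1) by (auto simp: refines_def)
  have DE: "D = E"
  proof (rule ccontr)
    assume ne: "D \<noteq> E"
    then have disj: "D \<inter> E = {}" using part(2) D E by (auto simp: partition_on_def disjoint_def)
    have "D \<noteq> {n + 1}" using D(1) single(2) by auto
    then obtain d where d: "d \<in> D" "d \<noteq> n + 1" using D(2) by blast
    moreover have "d \<in> {1..n + 1}" using d D part(2) by (auto simp: partition_on_def)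
    moreover have "d \<noteq> 1" "d \<noteq> n" using disj d B E by auto
    ultimately have "1 < d" "d < n" by auto
    \<comment> \<open>\<open>1\<close>, \<open>d\<close>, \<open>n\<close>, \<open>n + 1\<close>
      alternate between \<open>E\<close> and \<open>D\<close>.\<close>
    then have "crossing E D" unfolding crossing_def using B E D d by (metis less_add_one subsetD)
    then show False using NC(2) D E ne by (auto simp: noncrossing_partitions_iff)
  qed
  have Bsub: "B \<subseteq> {1..n + 1}" using part(1) B(1) by (auto simp: partition_on_def)
  have notin: "n + 1 \<notin> B"
  proof
    assume "n + 1 \<in> B"
    then have "B = {n + 1}" using partition_on_block_eq[OF part(1) B(1) single(1)] by blast
    then show False using B(3) by simp
  qed
  then have ne: "B \<noteq> {n + 1}" by auto
  \<comment> \<open>Absorbing \<open>n + 1\<close> into \<open>B\<close> alone gives a noncrossing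
    partition strictly above \<open>\<sigma>\<close> that refines \<open>\<tau>\<close>, hence
    \<open>\<tau>\<close> itself.\<close>
  define \<rho> where "\<rho> = insert (B \<union> {n + 1}) (\<sigma> - {B, {n + 1}})"
  have part\<rho>: "partition_on {1..n + 1} \<rho>"
  proof (rule partition_onI)
    show "\<Union>\<rho> = {1..n + 1}"
      using part(1) B(1) single(1) unfolding \<rho>_def partition_on_def by blast
    show "{} \<notin> \<rho>" using part(1) unfolding \<rho>_def partition_on_def by auto
    fix p q assume pq: "p \<in> \<rho>" "q \<in> \<rho>" "p \<noteq> q"
    have disj: "disjnt C D" if "C \<in> \<sigma>" "D \<in> \<sigma>" "C \<noteq> D" for C D
      using that partition_on_block_eq[OF part(1)] by (metis disjnt_iff)
    have *: "disjnt (B \<union> {n + 1}) C" if "C \<in> \<sigma> - {B, {n + 1}}" for C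
      using that disj[of B C] disj[of "{n + 1}" C] B(1) single(1) by (auto simp: disjnt_Un1)
    have "p = B \<union> {n + 1} \<or> p \<in> \<sigma> - {B, {n + 1}}" "q = B \<union> {n + 1} \<or> q \<in> \<sigma> - {B, {n + 1}}"
      using pq(1,2) by (simp_all only: \<rho>_def insert_iff)
    then show "disjnt p q"
      using pq(3) *[of p] *[of q] disj[of p q] by (elim disjE) (simp_all add: disjnt_sym)
  qed
  \<comment> \<open>\<open>C\<close> lies strictly between \<open>1\<close> and \<open>n\<close>, so
    in a crossing that uses \<open>n + 1\<close> this point comes last and can be replaced by
    \<open>n\<close>.\<close>
  have nocross: "\<not> crossing (B \<union> {n + 1}) C" if C: "C \<in> \<sigma>" "C \<noteq> B" "C \<noteq> {n + 1}" for C
  proof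
    assume cross: "crossing (B \<union> {n + 1}) C"
    have C': "C \<subseteq> {1..n + 1}"
      by (rule partition_on_block_subset[OF part(1) C(1)])
    have "C \<subseteq> {1<..<n}"
    proof
      fix v assume "v \<in> C"
      then have "v \<in> {1..n + 1}" "v \<noteq> 1" "v \<noteq> n" "v \<noteq> n + 1"
        using C' partition_on_block_eq[OF part(1) C(1) B(1), of v]
          partition_on_block_eq[OF part(1) C(1) single(1), of v] C B by auto
      then show "v \<in> {1<..<n}" by auto
    qed
    then have C'': "\<And>v. v \<in> C \<Longrightarrow> v < n" by auto
    from cross obtain a b c d where abcd: "a < b" "b < c" "c < d"
      "a \<in> B \<union> {n + 1} \<and> b \<in> C \<and> c \<in> B \<union> {n + 1} \<and> d \<in> C \<or>
       a \<in> C \<and> b \<in> B \<union> {n + 1} \<and> c \<in> C \<and> d \<in> B \<union> {n + 1}"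
      unfolding crossing_def by blast
    from abcd(4) have "crossing B C"
    proof
      assume *: "a \<in> B \<union> {n + 1} \<and> b \<in> C \<and> c \<in> B \<union> {n + 1} \<and> d \<in> C"
      then have "a \<in> B" "c \<in> B" using C''[of d] abcd by auto
      then show ?thesis unfolding crossing_def using * abcd(1-3) by blast
    next
      assume *: "a \<in> C \<and> b \<in> B \<union> {n + 1} \<and> c \<in> C \<and> d \<in> B \<union> {n + 1}"
      then have "b \<in> B" "c < n" using C''[of c] abcd by auto
      then show ?thesis unfolding crossing_def using * abcd(1-3) B(3) by blast
    qed
    then show False using NC(1) C B(1) by (auto simp: noncrossing_partitions_iff)
  qed
  have NC\<rho>: "\<rho> \<in> noncrossing_partitions (n + 1)"
    unfolding noncrossing_partitions_iff
  proof (intro conjI part\<rho> ballI impI)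
    fix X Y assume "X \<in> \<rho>" "Y \<in> \<rho>" "X \<noteq> Y"
    then show "\<not> crossing X Y"
      using nocross[of X] nocross[of Y] NC(1) crossing_commute[of X Y]
      unfolding \<rho>_def noncrossing_partitions_iff by blast
  qed
  have "refines {1..n + 1} \<sigma> \<rho>"
    unfolding refines_def using part(1) part\<rho> by (auto simp: \<rho>_def)
  moreover have "\<sigma> \<noteq> \<rho>"
  proof
    assume "\<sigma> = \<rho>"
    then have "B \<in> insert (B \<union> {n + 1}) (\<sigma> - {B, {n + 1}})" using B(1) by (simp add: \<rho>_def)
    then show False using notin by auto
  qed
  ultimately have less: "strictly_refines (n + 1) \<sigma> \<rho>" by (simp add: strictly_refines_def)
  have "B \<union> {n + 1} \<subseteq> E" using E D DE by auto
  then have "refines {1..n + 1} \<rho> \<tau>"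
    using ref part\<rho> E unfolding refines_def by (auto simp: \<rho>_def)
  then have \<tau>: "\<tau> = \<rho>" using no_between[OF NC\<rho> less] by simp
  have fin: "finite B" using Bsub finite_subset by blast
  have "Min (B \<union> {n + 1}) = 1"
    using Bsub B(2) fin by (intro Min_eqI) auto
  then have "cover_label \<sigma> \<tau> = Max {x \<in> B. \<forall>y\<in>{n + 1}. x < y}"
    using B single(1) ne \<tau> \<rho>_def by (intro cover_label_eq[OF part(1)]) auto
  also have "\<dots> = n"
    using fin B(3) by (intro Max_eqI) auto
  finally show ?thesis .
qed

section \<open>Partitions that no admissible chain meets\<close>

lemma nth_label_in_labels:
  "Suc k < length c \<Longrightarrow> cover_label (c ! k) (c ! Suc k) \<in> set (chain_labels c)"
  unfolding chain_labels_def set_map by (rule image_eqI[OF refl]) simp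

text \<open>Above \<open>\<sigma>\<close> in a chain \<open>1\<close> and \<open>n\<close> stay
  together, so the first step absorbing \<open>n + 1\<close> would have the forbidden label. Thus
  \<open>{n + 1}\<close> would survive up to the top, which has a single block.\<close>

lemma excluded_from_poset:
  assumes n: "2 \<le> n" and \<sigma>: "\<sigma> \<in> pf_poset n (parking_functions_without_max n)"
    and single: "{n + 1} \<in> \<sigma>" and B: "B \<in> \<sigma>" "1 \<in> B" "n \<in> B"
  shows False
proof -
  obtain c where c: "c \<in> pf_chains n (parking_functions_without_max n)" "\<sigma> \<in> set c"
    using \<sigma> by (auto simp: pf_poset_def)
  then have max: "c \<in> maximal_chains (n + 1)" and lab: "n \<notin> set (chain_labels c)"
    by (auto simp: pf_chains_def parking_functions_without_max_def)
  obtain i where i: "i < length c" "\<sigma> = c ! i" using c(2) by (metis in_set_conv_nth)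
  have NC: "c ! j \<in> noncrossing_partitions (n + 1)" if "j < length c" for j
    using maximal_chain_noncrossing[OF max] that by auto
  have stays: "{n + 1} \<in> c ! j" if "i \<le> j" "j < length c" for j
    using that
  proof (induction j rule: dec_induct)
    case base
    then show ?case using single i by simp
  next
    case (step j)
    then have mem: "{n + 1} \<in> c ! j" and j: "j < length c" by auto
    have "refines {1..n + 1} \<sigma> (c ! j)"
      using maximal_chain_less[OF max, of i j] step.hyps j i NC[OF j]
      by (cases "i = j") (auto simp: strictly_refines_def refines_refl noncrossing_partitions_iff)
    then obtain B' where B': "B' \<in> c ! j" "B \<subseteq> B'" using B(1) by (auto simp: refines_def)
    have ref: "refines {1..n + 1} (c ! j) (c ! Suc j)"
      using maximal_chain_less[OF max, of j "Suc j"] step.prems by (simp add: strictly_refines_def)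
    show ?case
    proof (rule ccontr)
      assume no: "{n + 1} \<notin> c ! Suc j"
      have "cover_label (c ! j) (c ! Suc j) = n"
        using B B' n maximal_chain_no_between[OF max step.prems]
        by (intro cover_label_joining_max[OF NC[OF j] NC[OF step.prems] ref _ mem no B'(1)]) auto
      then show False using nth_label_in_labels[OF step.prems] lab by simp
    qed
  qed
  obtain k where k: "k < length c" "c ! k = {{1..n + 1}}"
    using maximal_chain_top[OF max] by (metis in_set_conv_nth le_add2)
  \<comment> \<open>Otherwise the top would refine \<open>\<sigma>\<close>, which has the two blocks
    \<open>B\<close> and \<open>{n + 1}\<close>.\<close>
  have "i \<le> k"
  proof (rule ccontr)
    assume "\<not> i \<le> k"
    then have "refines {1..n + 1} {{1..n + 1}} \<sigma>"
      using maximal_chain_less[OF max, of k i] i k by (simp add: strictly_refines_def)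
    then have "card \<sigma> \<le> card {{1..n + 1}}" by (intro card_le_of_refines) auto
    moreover have "finite \<sigma>" using NC[OF i(1)] i(2) finite_elements[of "{1..n + 1}"]
      by (auto simp: noncrossing_partitions_iff)
    ultimately have "B = {n + 1}" using B(1) single by (auto simp: card_le_Suc0_iff_eq)
    then show False using B(3) by simp
  qed
  then have "{n + 1} \<in> {{1..n + 1}}" using stays[of k] k by simp
  then have "1 \<in> {n + 1}" by simp
  then show False using n by simp
qed

text \<open>\<open>K\<close> tells apart the atoms of the two factors of a hypothetical product.\<close>

context
  fixes n :: nat and K :: "nat set set \<Rightarrow> bool" and X :: "nat list set"
  defines "X \<equiv> parking_functions_without_max n"
  assumes n: "2 \<le> n"
    and separates: "\<And>\<alpha> \<beta>. pf_atom n X \<alpha> \<Longrightarrow> pf_atom n X \<beta> \<Longrightarrow> K \<alpha> \<Longrightarrow> \<not> K \<beta> \<Longrightarrow>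
      \<exists>c\<in>pf_poset n X. c \<noteq> singletons n \<and> c \<noteq> \<alpha> \<and> c \<noteq> \<beta> \<and>
        down_set (pf_poset n X) (pf_order n X) c = {singletons n, \<alpha>, \<beta>, c}"
begin

text \<open>The element that separation provides covers both atoms, and a common cover of two pairs
  sharing a point can only be the triangle.\<close>

lemma diamond_of_separated_pairs:
  assumes "x \<noteq> y" "x \<noteq> w" "y \<noteq> w" "{x, y, w} \<subseteq> {1..n + 1}"
    and at: "pf_atom n X (single_block n {x, y})" "pf_atom n X (single_block n {x, w})"
    and K: "K (single_block n {x, y}) \<noteq> K (single_block n {x, w})"
  shows "single_block n {x, y, w} \<in> pf_poset n X"
    and "down_set (pf_poset n X) (pf_order n X) (single_block n {x, y, w}) =
      {singletons n, single_block n {x, y}, single_block n {x, w}, single_block n {x, y, w}}"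
proof -
  let ?\<alpha> = "single_block n {x, y}" and ?\<beta> = "single_block n {x, w}"
  obtain c where c: "c \<in> pf_poset n X" "c \<noteq> ?\<alpha>" "c \<noteq> ?\<beta>"
      "down_set (pf_poset n X) (pf_order n X) c = {singletons n, ?\<alpha>, ?\<beta>, c}"
  \<comment> \<open>The separation hypothesis is directed, so the atoms are swapped when
    \<open>K\<close> holds for the second one.\<close>
  proof (cases "K ?\<alpha>")
    case True
    then show thesis using separates[OF at] K that by blast
  next
    case False
    then obtain c where "c \<in> pf_poset n X" "c \<noteq> ?\<alpha>" "c \<noteq> ?\<beta>"
        "down_set (pf_poset n X) (pf_order n X) c = {singletons n, ?\<beta>, ?\<alpha>, c}"
      using separates[OF at(2,1)] K by blast
    then show thesis using that[of c] by (simp add: insert_commute)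
  qed
  have "?\<alpha> \<noteq> ?\<beta>" using K by auto
  then have "(?\<alpha>, c) \<in> pf_covers n X" "(?\<beta>, c) \<in> pf_covers n X"
    using covers_of_diamond[OF at _ c(2,4)] covers_of_diamond[OF at(2,1) _ c(3)] c(4)
    by (auto simp: insert_commute)
  then have "c = single_block n {x, y, w}"
    using assms(1-4) by (intro common_cover_of_pairs)
  then show "single_block n {x, y, w} \<in> pf_poset n X"
    and "down_set (pf_poset n X) (pf_order n X) (single_block n {x, y, w}) =
      {singletons n, ?\<alpha>, ?\<beta>, single_block n {x, y, w}}"
    using c by auto
qed

text \<open>The partition with the block \<open>{x, y, w}\<close> lies above three atoms, one too many for a product
  of two atoms.\<close>

lemma same_factor_triangle:
  assumes "x \<noteq> y" "x \<noteq> w" "y \<noteq> w" "{x, y, w} \<subseteq> {1..n + 1}"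
    and "n \<notin> {x, y, w}" "n + 1 \<in> {x, y, w}"
  shows "K (single_block n {x, y}) = K (single_block n {x, w})"
proof (rule ccontr)
  assume K: "K (single_block n {x, y}) \<noteq> K (single_block n {x, w})"
  have at: "pf_atom n X (single_block n {x, y})" "pf_atom n X (single_block n {x, w})"
    unfolding pf_atom_iff X_def
    using triangle_covers(1)[of x y w] triangle_covers(1)[of x w y] assms by auto
  have "(single_block n {y, w}, single_block n {y, w, x}) \<in> pf_covers n X"
    unfolding X_def using assms by (intro triangle_covers(2)) auto
  then have "single_block n {y, w} \<in> down_set (pf_poset n X) (pf_order n X) (single_block n {x, y, w})"
    using pf_covers_in_order pf_covers_in_poset by (simp add: down_set_def insert_commute)
  then have "single_block n {y, w} \<in>
      {singletons n, single_block n {x, y}, single_block n {x, w}, single_block n {x, y, w}}"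
    using diamond_of_separated_pairs(2)[OF assms(1-4) at K] by simp
  moreover have "single_block n {y, w} \<noteq> single_block n Z" if "x \<in> Z" for Z
    using one_block_inject[of _ "{y, w}" Z y w] assms(1-3) that by blast
  moreover have "single_block n {y, w} \<noteq> singletons n"
    using triangle_covers(1)[of y w x n] assms pf_covers_less
    by (fastforce simp: strictly_refines_def)
  ultimately show False by auto
qed

text \<open>The only candidate for a cover of both atoms is not in the poset.\<close>

lemma same_factor_excluded:
  assumes i: "1 < i" "i < n" and at: "pf_atom n X (single_block n {i, n})"
  shows "K (single_block n {i, n}) = K (single_block n {i, 1})"
proof (rule ccontr)
  assume K: "K (single_block n {i, n}) \<noteq> K (single_block n {i, 1})"
  have "pf_atom n X (single_block n {i, 1})"
    unfolding pf_atom_iff X_def using i by (intro triangle_covers(1)[of _ _ "n + 1"]) auto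
  then have "single_block n {i, n, 1} \<in> pf_poset n X"
    using i at K by (intro diamond_of_separated_pairs(1)) auto
  then show False
    using i n unfolding X_def
    by (intro excluded_from_poset[of n "single_block n {i, n, 1}" "{i, n, 1}"])
      (auto simp: one_block_def)
qed

text \<open>The step from the discrete partition would already have the forbidden label: the minimum
  \<open>n\<close> is the only point of its block and lies below \<open>n + 1\<close>.\<close>

lemma pair_max_not_atom: "\<not> pf_atom n X (single_block n {n, n + 1})"
proof
  assume "pf_atom n X (single_block n {n, n + 1})"
  then obtain c k where c: "c \<in> pf_chains n X" "Suc k < length c"
      "c ! k = singletons n" "c ! Suc k = single_block n {n, n + 1}"
    unfolding pf_atom_iff pf_covers_def by auto
  have "cover_label (single_block n {n}) (single_block n (insert (n + 1) {n})) = n"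
    using cover_label_one_block[of "{1..n + 1}" "{n}" "n + 1"] n by auto
  moreover have "single_block n {n} = singletons n" using n by (intro one_block_singleton) auto
  ultimately have "cover_label (c ! k) (c ! Suc k) = n"
    unfolding c by (simp add: insert_commute)
  then have "n \<in> set (chain_labels c)" using nth_label_in_labels[OF c(2)] by simp
  then show False using c(1) by (simp add: X_def pf_chains_def parking_functions_without_max_def)
qed

text \<open>Everything is compared with the pair \<open>{1, n + 1}\<close>:
  \<open>{i, n + 1}\<close> and \<open>{1, i}\<close> through the triangle
  \<open>{1, i, n + 1}\<close>, \<open>{i, j}\<close> with \<open>j < n\<close> through
  \<open>{i, n + 1}\<close>, and \<open>{i, n}\<close> through \<open>{1, i}\<close>. For
  \<open>n = 2\<close> only the reference pair itself survives the case distinction.\<close>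

lemma all_atoms_in_same_factor:
  assumes "pf_atom n X \<alpha>"
  shows "K \<alpha> = K (single_block n {1, n + 1})"
proof -
  have V: "K (single_block n {i, 1}) = K (single_block n {1, n + 1})" if "1 < i" "i < n" for i
    using same_factor_triangle[of 1 i "n + 1"] that by (auto simp: insert_commute)
  have W: "K (single_block n {i, n + 1}) = K (single_block n {1, n + 1})" if "i \<in> {1..<n}" for i
    using same_factor_triangle[of "n + 1" i 1] that by (cases "i = 1") (auto simp: insert_commute)
  obtain i j where ij: "1 \<le> i" "i < j" "j \<le> n + 1" "\<alpha> = single_block n {i, j}"
    using pf_atom_is_pair[OF assms] by blast
  consider "j = n + 1" "i < n" | "i = n" "j = n + 1" | "j = n" "i = 1" | "j = n" "1 < i" "i < n" | "j < n"
    using ij by linarith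
  then show ?thesis
  proof cases
    case 1
    then show ?thesis using W[of i] ij by simp
  next
    case 2
    then have False using pair_max_not_atom assms ij(4) by metis
    then show ?thesis ..
  next
    case 3
    have "\<alpha> \<in> pf_poset n X" using assms by (simp add: is_atom_def)
    then have False
      using 3 n ij unfolding X_def
      by (intro excluded_from_poset[of n \<alpha> "{i, j}"]) (auto simp: one_block_def)
    then show ?thesis ..
  next
    case 4
    then show ?thesis using same_factor_excluded[of i] V[of i] assms ij by simp
  next
    case 5
    then have "K (single_block n {i, j}) = K (single_block n {i, n + 1})"
      using ij by (intro same_factor_triangle) auto
    then show ?thesis using W[of i] ij 5 by simp
  qed
qed

end

theorem proposition2p6:
  fixes n :: nat
    and P :: "'p set" and R :: "'p rel"
    and Q :: "'q set" and S :: "'q rel"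
  assumes "n \<ge> 2"
    and "partial_order_on P R" and "\<exists>x\<in>P. \<exists>y\<in>P. x \<noteq> y"
    and "partial_order_on Q S" and "\<exists>x\<in>Q. \<exists>y\<in>Q. x \<noteq> y"
  shows "\<not> poset_isomorphic
           (pf_poset n (parking_functions_without_max n)) (pf_order n (parking_functions_without_max n))
           (P \<times> Q) (prod_order R S)"
proof
  let ?X = "parking_functions_without_max n"
  assume iso: "poset_isomorphic (pf_poset n ?X) (pf_order n ?X) (P \<times> Q) (prod_order R S)"
  \<comment> \<open>The poset inherits nonemptiness from the assumed bijection, so no chain has to
    be exhibited for it.\<close>
  have "P \<times> Q \<noteq> {}" using assms(3,5) by auto
  then have "pf_poset n ?X \<noteq> {}"
    using iso by (auto simp: poset_isomorphic_def bij_betw_def)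
  then obtain \<sigma> where "\<sigma> \<in> pf_poset n ?X" by blast
  from singletons_least(1)[OF this] have bot: "singletons n \<in> pf_poset n ?X" .
  obtain K where K: "\<exists>\<alpha>. pf_atom n ?X \<alpha> \<and> K \<alpha>" "\<exists>\<beta>. pf_atom n ?X \<beta> \<and> \<not> K \<beta>"
    and separates: "\<And>\<alpha> \<beta>. pf_atom n ?X \<alpha> \<Longrightarrow> pf_atom n ?X \<beta> \<Longrightarrow> K \<alpha> \<Longrightarrow> \<not> K \<beta> \<Longrightarrow>
      \<exists>c\<in>pf_poset n ?X. c \<noteq> singletons n \<and> c \<noteq> \<alpha> \<and> c \<noteq> \<beta> \<and>
        down_set (pf_poset n ?X) (pf_order n ?X) c = {singletons n, \<alpha>, \<beta>, c}"
    using product_separates_atoms[OF iso finite_pf_poset bot singletons_least(2) assms(2-5)] by blast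
  show False
    using K all_atoms_in_same_factor[OF assms(1) separates] by blast
qed

end
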